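(* Let $n_1\le n_2$, let $\Phi:\mathbb{R}^{n_1\times n_2}\to\mathbb{R}^m$ be a linear operator and $M_0\in\mathbb{R}^m$. Suppose that $X_0$ is an optimal solution of the problem $$\min_{X\in\mathbb{R}^{n_1\times n_2}}\ \|X\|_*\quad\text{subject to}\quad\Phi X=M_0 .$$ Let $\Delta(X_0):=\operatorname{Im}\Phi^*\cap\partial\|X_0\|_*$ be the set of dual certificates (which is nonempty), and let $q(X_0):=\min\{p(Y)\mid Y\in\Delta(X_0)\}$. The following are equivalent: (i) $X_0$ is a strong solution of the problem. (ii) $\displaystyle\bigcap_{Y\in\Delta(X_0)}\big[\operatorname{Ker}\Phi\cap T_{N_{\mathbb{B}}(Y)}(X_0)\big]=\{0\}$. (iii) There exists a dual certificate $\bar Y\in\Delta(X_0)$ such that $\operatorname{Ker}\Phi\cap T_{N_{\mathbb{B}}(\bar Y)}(X_0)=\{0\}$. (iv) For every $Y\in\Delta(X_0)$ satisfying $p(Y)=q(X_0)$, one has $\operatorname{Ker}\Phi\cap T_{N_{\mathbb{B}}(Y)}(X_0)=\{0\}$.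
   Context: $\mathbb{R}^{n_1\times n_2}$ carries the inner product $\langle X,Y\rangle=\operatorname{Tr}(X^TY)$ with Frobenius norm $\|\cdot\|_F$; $\|\cdot\|_*$ is the nuclear norm, $\|\cdot\|$ the spectral norm, $\partial\|X_0\|_*$ the convex subdifferential of the nuclear norm at $X_0$. $\mathbb{B}=\{Z\mid\|Z\|\le1\}$ and $N_{\mathbb{B}}(Y)=\{X\mid\langle X,Z-Y\rangle\le0\ \forall Z\in\mathbb{B}\}$ for $Y\in\mathbb{B}$. $p(Y)=\#\{i\mid\sigma_i(Y)=1\}$ is the number of singular values of $Y$ equal to $1$. For $Y\in\partial\|X_0\|_*$ one has $X_0\in N_{\mathbb{B}}(Y)$. The contingent cone to a closed set $K$ at $X_0\in K$ is $T_K(X_0)=\{W\mid\exists\, t_k\downarrow0,\ W_k\to W,\ X_0+t_kW_k\in K\}$. $X_0$ (with $\Phi X_0=M_0$) is a strong solution of the problem if there exist $c,\varepsilon>0$ with $\|X\|_*-\|X_0\|_*\ge c\|X-X_0\|_F^2$ for all $X$ with $\Phi X=M_0$ and $\|X-X_0\|_F\le\varepsilon$. *)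

theory Defs
  imports "HOL-Analysis.Analysis" "HOL-Library.Multiset"
begin

text \<open>An \<open>n1 \<times> n2\<close> matrix is an element of \<^typ>\<open>real^'n2^'n1\<close>. The library's inner product and norm
  on this type are the trace inner product and the Frobenius norm.\<close>

lemma inner_matrix_eq_trace:
  fixes X Y :: "real^'n2^'n1"
  shows "X \<bullet> Y = trace (transpose X ** Y)"
proof -
  have "X \<bullet> Y = (\<Sum>i\<in>UNIV. \<Sum>j\<in>UNIV. X $ i $ j * Y $ i $ j)"
    by (simp add: inner_vec_def)
  also have "\<dots> = (\<Sum>j\<in>UNIV. \<Sum>i\<in>UNIV. X $ i $ j * Y $ i $ j)"
    by (rule sum.swap)
  finally show ?thesis
    by (simp add: trace_def matrix_matrix_mult_def transpose_def)
qed


definition eigenspace :: "real^'n^'n \<Rightarrow> real \<Rightarrow> (real^'n) set" where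
  "eigenspace A \<mu> = {v. A *v v = \<mu> *\<^sub>R v}"

text \<open>The singular values of an \<open>n1 \<times> n2\<close> matrix \<open>A\<close>, \<open>n1 \<le> n2\<close>, are the nonnegative square
  roots of the \<open>n1\<close> eigenvalues of \<open>A A\<^sup>T\<close>, repeated according to multiplicity. As \<open>A A\<^sup>T\<close> is
  symmetric, the multiplicity of an eigenvalue is the dimension of its eigenspace. The lemma
  \<open>finite_singular_values\<close> below shows that the sum ranges over a finite set.\<close>

definition singular_values :: "real^'n2^'n1 \<Rightarrow> real multiset" where
  "singular_values A =
    (\<Sum>s \<in> {s. 0 \<le> s \<and> (\<exists>v. v \<noteq> 0 \<and> v \<in> eigenspace (A ** transpose A) (s\<^sup>2))}.
       replicate_mset (dim (eigenspace (A ** transpose A) (s\<^sup>2))) s)"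

lemma finite_singular_values:
  fixes A :: "real^'n2^'n1"
  shows "finite {s. 0 \<le> s \<and> (\<exists>v. v \<noteq> 0 \<and> v \<in> eigenspace (A ** transpose A) (s\<^sup>2))}" (is "finite ?S")
proof -
  define B where "B = A ** transpose A"
  have adj: "(A *v z) \<bullet> y = z \<bullet> (transpose A *v y)" for y z
    by (metis dot_lmul_matrix inner_commute transpose_matrix_vector)
  have sym: "(B *v x) \<bullet> y = x \<bullet> (B *v y)" for x y
    unfolding B_def by (metis adj inner_commute matrix_vector_mul_assoc)
  define S where "S = ?S"
  define f where "f s = (SOME v. v \<noteq> 0 \<and> v \<in> eigenspace B (s\<^sup>2))" for s
  have f: "f s \<noteq> 0 \<and> f s \<in> eigenspace B (s\<^sup>2)" if "s \<in> S" for s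
  proof -
    have "\<exists>v. v \<noteq> 0 \<and> v \<in> eigenspace B (s\<^sup>2)"
      using that unfolding S_def B_def by blast
    then show ?thesis
      unfolding f_def by (rule someI_ex)
  qed
  have orth: "f s \<bullet> f t = 0" if "s \<in> S" "t \<in> S" "s \<noteq> t" for s t
  proof -
    have "B *v f s = s\<^sup>2 *\<^sub>R f s" "B *v f t = t\<^sup>2 *\<^sub>R f t"
      using f that unfolding eigenspace_def by blast+
    then have "s\<^sup>2 * (f s \<bullet> f t) = t\<^sup>2 * (f s \<bullet> f t)"
      using sym[of "f s" "f t"] by (simp only: inner_scaleR_left inner_scaleR_right)
    moreover have "0 \<le> s" "0 \<le> t"
      using that(1,2) unfolding S_def by blast+
    then have "s\<^sup>2 \<noteq> t\<^sup>2"
      using that(3) by simp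
    ultimately show ?thesis
      by simp
  qed
  have "inj_on f S"
  proof (rule inj_onI, rule ccontr)
    fix s t
    assume "s \<in> S" "t \<in> S" "f s = f t" "s \<noteq> t"
    then have "f s \<bullet> f s = 0" and "f s \<noteq> 0"
      using orth[of s t] f[of s] by simp_all
    then show False
      by simp
  qed
  have "pairwise orthogonal (f ` S)"
    unfolding pairwise_def orthogonal_def using orth by blast
  moreover have "0 \<notin> f ` S"
    using f by force
  ultimately have "finite (f ` S)"
    using pairwise_orthogonal_independent independent_imp_finite by blast
  then have "finite S"
    using \<open>inj_on f S\<close> by (rule finite_imageD)
  then show ?thesis
    unfolding S_def .
qed

definition nuclear_norm :: "real^'n2^'n1 \<Rightarrow> real" where
  "nuclear_norm A = sum_mset (singular_values A)"

definition spectral_norm :: "real^'n2^'n1 \<Rightarrow> real" where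
  "spectral_norm A = onorm ((*v) A)"

definition spectral_ball :: "(real^'n2^'n1) set" where
  "spectral_ball = {Z. spectral_norm Z \<le> 1}"

definition num_unit_singular_values :: "real^'n2^'n1 \<Rightarrow> nat" where
  "num_unit_singular_values Y = count (singular_values Y) 1"


definition subdifferential :: "('a::real_inner \<Rightarrow> real) \<Rightarrow> 'a \<Rightarrow> 'a set" where
  "subdifferential f x = {y. \<forall>z. f z \<ge> f x + y \<bullet> (z - x)}"

definition normal_cone :: "'a::real_inner set \<Rightarrow> 'a \<Rightarrow> 'a set" where
  "normal_cone C y = {x. \<forall>z\<in>C. x \<bullet> (z - y) \<le> 0}"

definition contingent_cone :: "'a::real_normed_vector set \<Rightarrow> 'a \<Rightarrow> 'a set" where
  "contingent_cone K x =
    {w. \<exists>t W. (\<forall>k::nat. t k > 0) \<and> t \<longlonglongrightarrow> 0 \<and> W \<longlonglongrightarrow> w \<and> (\<forall>k. x + t k *\<^sub>R W k \<in> K)}"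


definition optimal_solution :: "(real^'n2^'n1 \<Rightarrow> real^'m) \<Rightarrow> real^'m \<Rightarrow> real^'n2^'n1 \<Rightarrow> bool" where
  "optimal_solution \<Phi> M\<^sub>0 X\<^sub>0 \<longleftrightarrow>
    \<Phi> X\<^sub>0 = M\<^sub>0 \<and> (\<forall>X. \<Phi> X = M\<^sub>0 \<longrightarrow> nuclear_norm X\<^sub>0 \<le> nuclear_norm X)"

definition strong_solution :: "(real^'n2^'n1 \<Rightarrow> real^'m) \<Rightarrow> real^'m \<Rightarrow> real^'n2^'n1 \<Rightarrow> bool" where
  "strong_solution \<Phi> M\<^sub>0 X\<^sub>0 \<longleftrightarrow>
    \<Phi> X\<^sub>0 = M\<^sub>0 \<and>
    (\<exists>c>0. \<exists>\<epsilon>>0. \<forall>X. \<Phi> X = M\<^sub>0 \<and> norm (X - X\<^sub>0) \<le> \<epsilon> \<longrightarrow>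
       nuclear_norm X - nuclear_norm X\<^sub>0 \<ge> c * (norm (X - X\<^sub>0))\<^sup>2)"

definition dual_certificate_set :: "(real^'n2^'n1 \<Rightarrow> real^'m) \<Rightarrow> real^'n2^'n1 \<Rightarrow> (real^'n2^'n1) set" where
  "dual_certificate_set \<Phi> X\<^sub>0 = range (adjoint \<Phi>) \<inter> subdifferential nuclear_norm X\<^sub>0"

text \<open>On a nonempty set of natural numbers, \<^const>\<open>Inf\<close> is the minimum.\<close>

definition min_unit_singular_values :: "(real^'n2^'n1 \<Rightarrow> real^'m) \<Rightarrow> real^'n2^'n1 \<Rightarrow> nat" where
  "min_unit_singular_values \<Phi> X\<^sub>0 = (INF Y\<in>dual_certificate_set \<Phi> X\<^sub>0. num_unit_singular_values Y)"

definition ker :: "('a \<Rightarrow> 'b::zero) \<Rightarrow> 'a set" where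
  "ker f = {x. f x = 0}"

end

theory Submission
  imports Defs
begin

text \<open>A matrix \<open>X\<close> lies in the normal cone of the spectral ball at \<open>Y\<close> iff \<open>X = S Y\<close> with \<open>S\<close> symmetric
  positive semidefinite and supported on the eigenspace \<open>E\<close> of \<open>Y Y\<^sup>T\<close> for the eigenvalue \<open>1\<close>, whose
  dimension is \<open>p(Y)\<close>. Strict convexity of the Euclidean norm shrinks \<open>E\<close> when two certificates are
  averaged; hence a certificate with minimal \<open>p\<close> has the smallest normal cone, and (ii), (iii) and (iv)
  all concern that single cone.

  The gap \<open>\<parallel>X\<parallel>\<^sub>* - \<langle>X, Y\<rangle>\<close> dominates, locally, the squared distance of \<open>X\<close> to the normal cone at \<open>Y\<close>.
  So if growth fails along feasible points, the limiting direction is tangent to that cone, which gives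
  (iii) \<open>\<Longrightarrow>\<close> (i). Conversely, a tangent direction \<open>W\<close> integrates to an arc \<open>X\<^sub>0 + t W + t\<^sup>2 C\<close> inside the
  cone at a minimal certificate, and a separation argument replaces \<open>C\<close> by a kernel direction at an
  arbitrarily small second-order cost, so that quadratic growth forces \<open>W = 0\<close>.\<close>

section \<open>Self-adjoint operators\<close>

lemma quadratic_nonneg_imp_linear_zero:
  fixes \<alpha> \<beta> :: real
  assumes "\<And>t. 0 \<le> 2 * t * \<alpha> + t\<^sup>2 * \<beta>" and "0 \<le> \<beta>"
  shows "\<alpha> = 0"
proof -
  \<comment> \<open>Near the minimiser of the quadratic; \<open>\<beta> + 1\<close> in place of
    \<open>\<beta>\<close> avoids a division by zero, and the form takes the value
    \<open>- t^2 (\<beta> + 2)\<close> there.\<close>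
  define t where "t = - \<alpha> / (\<beta> + 1)"
  have \<alpha>: "\<alpha> = - t * (\<beta> + 1)"
    using assms(2) by (simp add: t_def field_simps)
  have "2 * t * \<alpha> + t\<^sup>2 * \<beta> = - (t\<^sup>2 * (\<beta> + 2))"
    unfolding \<alpha> by (simp add: algebra_simps power2_eq_square)
  then have "t\<^sup>2 * (\<beta> + 2) \<le> 0"
    using assms(1)[of t] by simp
  then have "t = 0"
    using assms(2) by (simp add: mult_le_0_iff)
  then show ?thesis
    using \<alpha> by simp
qed

text \<open>By compactness the Rayleigh quotient has a maximiser on the unit sphere of
  \<open>S\<close>, and the first-order condition there is the eigenvector equation.\<close>

lemma selfadjoint_has_eigenvector:
  fixes T :: "'a::euclidean_space \<Rightarrow> 'a"
  assumes T: "linear T" and sa: "\<And>x y. T x \<bullet> y = x \<bullet> T y"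
    and S: "subspace S" "T ` S \<subseteq> S" "S \<noteq> {0}"
  obtains b \<mu> where "b \<in> S" "norm b = 1" "T b = \<mu> *\<^sub>R b"
proof -
  obtain v where v: "v \<in> S" "v \<noteq> 0"
    using S subspace_0 by blast
  have "sgn v \<in> S \<inter> sphere 0 1"
    using v S(1) by (simp add: sgn_div_norm subspace_scale)
  moreover have "compact (S \<inter> sphere 0 1)"
    by (rule closed_Int_compact[OF closed_subspace[OF S(1)] compact_sphere])
  moreover have "continuous_on (S \<inter> sphere 0 1) (\<lambda>x. x \<bullet> T x)"
    using T by (intro continuous_intros linear_continuous_on) (simp add: linear_conv_bounded_linear)
  ultimately obtain b where b: "b \<in> S \<inter> sphere 0 1"
    and max: "\<And>x. x \<in> S \<inter> sphere 0 1 \<Longrightarrow> x \<bullet> T x \<le> b \<bullet> T b"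
    using continuous_attains_sup[of "S \<inter> sphere 0 1" "\<lambda>x. x \<bullet> T x"] by (metis empty_iff)
  define \<mu> where "\<mu> = b \<bullet> T b"
  have bb: "b \<bullet> b = 1" "b \<in> S"
    using b by (auto simp: norm_eq_1)
  have nonneg: "0 \<le> \<mu> * (x \<bullet> x) - x \<bullet> T x" if "x \<in> S" for x
  proof (cases "x = 0")
    case False
    have "sgn x \<in> S \<inter> sphere 0 1"
      using that False S(1) by (simp add: sgn_div_norm subspace_scale)
    then have "sgn x \<bullet> T (sgn x) \<le> \<mu>"
      unfolding \<mu>_def by (rule max)
    then have "(x \<bullet> T x) / (norm x)\<^sup>2 \<le> \<mu>"
      by (simp add: sgn_div_norm linear_cmul[OF T] power2_eq_square divide_inverse mult_ac)
    then show ?thesis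
      using False by (simp add: divide_le_eq power2_norm_eq_inner)
  qed (simp add: linear_0[OF T])
  \<comment> \<open>The residual of the eigenvector equation. The form
    \<open>\<mu> * (x \<bullet> x) - x \<bullet> T x\<close> is nonnegative on \<open>S\<close> and
    vanishes at \<open>b\<close>; its linear term along \<open>b + t y\<close> is
    \<open>2 t (y \<bullet> y)\<close>, so \<open>y\<close> must be zero.\<close>
  define y where "y = \<mu> *\<^sub>R b - T b"
  have y: "y \<in> S"
    unfolding y_def using S bb(2) by (intro subspace_diff subspace_scale) auto
  have "0 \<le> 2 * t * (y \<bullet> y) + t\<^sup>2 * (\<mu> * (y \<bullet> y) - y \<bullet> T y)" for t
  proof -
    have "b + t *\<^sub>R y \<in> S"
      using bb(2) y S(1) by (intro subspace_add subspace_scale)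
    note nonneg[OF this]
    moreover have "(b + t *\<^sub>R y) \<bullet> (b + t *\<^sub>R y) = 1 + 2 * t * (b \<bullet> y) + t\<^sup>2 * (y \<bullet> y)"
      using inner_commute[of y b] by (simp add: inner_simps bb power2_eq_square algebra_simps)
    moreover have "(b + t *\<^sub>R y) \<bullet> T (b + t *\<^sub>R y) = \<mu> + 2 * t * (T b \<bullet> y) + t\<^sup>2 * (y \<bullet> T y)"
      using sa[of b y] inner_commute[of y "T b"]
      by (simp add: linear_add[OF T] linear_cmul[OF T] inner_simps \<mu>_def power2_eq_square algebra_simps)
    ultimately have "0 \<le> \<mu> * (1 + 2 * t * (b \<bullet> y) + t\<^sup>2 * (y \<bullet> y))
       - (\<mu> + 2 * t * (T b \<bullet> y) + t\<^sup>2 * (y \<bullet> T y))"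
      by simp
    also have "\<dots> = 2 * t * (\<mu> * (b \<bullet> y) - T b \<bullet> y) + t\<^sup>2 * (\<mu> * (y \<bullet> y) - y \<bullet> T y)"
      by (simp add: algebra_simps \<mu>_def bb)
    also have "\<mu> * (b \<bullet> y) - T b \<bullet> y = y \<bullet> y"
      by (subst (3) y_def) (simp add: inner_simps)
    finally show ?thesis .
  qed
  then have "y \<bullet> y = 0"
    using nonneg[OF y] by (rule quadratic_nonneg_imp_linear_zero)
  then have "T b = \<mu> *\<^sub>R b"
    by (simp add: y_def)
  then show thesis
    using that bb by (simp add: norm_eq_1)
qed

definition orthonormal_basis :: "'a::euclidean_space set \<Rightarrow> bool" where
  "orthonormal_basis U \<longleftrightarrow> pairwise orthogonal U \<and> (\<forall>u\<in>U. norm u = 1) \<and> span U = UNIV"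

text \<open>Induction on the dimension: self-adjointness makes the orthogonal complement of an
  eigenvector within \<open>S\<close> invariant again.\<close>

lemma selfadjoint_eigenbasis_subspace:
  fixes T :: "'a::euclidean_space \<Rightarrow> 'a"
  assumes T: "linear T" and sa: "\<And>x y. T x \<bullet> y = x \<bullet> T y"
    and "subspace S" "T ` S \<subseteq> S"
  shows "\<exists>B. pairwise orthogonal B \<and> (\<forall>b\<in>B. norm b = 1 \<and> (\<exists>\<mu>. T b = \<mu> *\<^sub>R b)) \<and> span B = S"
  using assms(3,4)
proof (induction "dim S" arbitrary: S rule: less_induct)
  case less
  show ?case
  proof (cases "S = {0}")
    case True
    then show ?thesis
      by (intro exI[of _ "{}"]) auto
  next
    case False
    obtain b \<mu> where b: "b \<in> S" "norm b = 1" "T b = \<mu> *\<^sub>R b"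
      using selfadjoint_has_eigenvector[OF T sa less.prems False] by metis
    define S' where "S' = {x \<in> S. b \<bullet> x = 0}"
    have sub: "subspace S'"
      using less.prems(1) unfolding S'_def subspace_def by (auto simp: inner_simps)
    have "T x \<in> S'" if "x \<in> S'" for x
      using that less.prems(2) sa[of b x] b(3) unfolding S'_def by auto
    then have inv: "T ` S' \<subseteq> S'" by blast
    have "S' \<subset> S"
    proof -
      have "S' \<subseteq> S" "b \<notin> S'"
        using b(2) unfolding S'_def by (auto simp: norm_eq_1)
      then show ?thesis
        using b(1) by blast
    qed
    then have "dim S' < dim S"
      using dim_psubset[of S' S] span_eq_iff sub less.prems(1) by metis
    from less.hyps[OF this sub inv] obtain B
      where B: "pairwise orthogonal B" "\<forall>b\<in>B. norm b = 1 \<and> (\<exists>\<mu>. T b = \<mu> *\<^sub>R b)" "span B = S'"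
      by blast
    have bS: "B \<subseteq> S'"
      using B(3) span_superset by blast
    have "span (insert b B) = S"
    proof
      show "span (insert b B) \<subseteq> S"
        using bS b(1) less.prems(1) unfolding S'_def by (intro span_minimal) auto
      show "S \<subseteq> span (insert b B)"
      proof
        fix x assume x: "x \<in> S"
        have "x - (b \<bullet> x) *\<^sub>R b \<in> S'"
          using x b less.prems(1) unfolding S'_def
          by (simp add: subspace_diff subspace_scale inner_simps norm_eq_1)
        then show "x \<in> span (insert b B)"
          unfolding span_insert using B(3) by blast
      qed
    qed
    moreover have "pairwise orthogonal (insert b B)"
      using B(1) bS unfolding S'_def by (auto simp: pairwise_insert orthogonal_def inner_commute)
    ultimately show ?thesis
      using B(2) b by (intro exI[of _ "insert b B"]) auto
  qed
qed

lemma selfadjoint_eigenbasis: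
  fixes T :: "'a::euclidean_space \<Rightarrow> 'a"
  assumes "linear T" "\<And>x y. T x \<bullet> y = x \<bullet> T y"
  obtains U \<mu> where "orthonormal_basis U" "\<And>u. u \<in> U \<Longrightarrow> T u = \<mu> u *\<^sub>R u"
proof -
  obtain B where B: "pairwise orthogonal B" "\<forall>b\<in>B. norm b = 1 \<and> (\<exists>\<mu>. T b = \<mu> *\<^sub>R b)" "span B = UNIV"
    using selfadjoint_eigenbasis_subspace[OF assms, of UNIV] by auto
  then obtain \<mu> where "\<forall>b\<in>B. T b = \<mu> b *\<^sub>R b"
    by metis
  then show thesis
    using B that[of B \<mu>] by (auto simp: orthonormal_basis_def)
qed

section \<open>Coordinates in an orthonormal basis\<close>

context
  fixes U :: "'a::euclidean_space set"
  assumes U: "orthonormal_basis U"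
begin

lemma orthonormal_basis_independent: "independent U"
  using U by (intro pairwise_orthogonal_independent) (auto simp: orthonormal_basis_def)

lemma orthonormal_basis_finite: "finite U"
  using orthonormal_basis_independent by (rule independent_imp_finite)

lemma orthonormal_basis_norm: "u \<in> U \<Longrightarrow> norm u = 1"
  using U by (simp add: orthonormal_basis_def)

lemma orthonormal_basis_inner: "u \<in> U \<Longrightarrow> v \<in> U \<Longrightarrow> u \<bullet> v = (if u = v then 1 else 0)"
  using U by (auto simp: orthonormal_basis_def pairwise_def orthogonal_def norm_eq_1)

lemma orthonormal_basis_sum: "(\<Sum>u\<in>U. (u \<bullet> x) *\<^sub>R u) = x"
  using orthonormal_basis_expand[of U x] U orthonormal_basis_finite
  by (simp add: orthonormal_basis_def inner_commute)

lemma orthonormal_basis_inner_sum: "x \<bullet> y = (\<Sum>u\<in>U. (u \<bullet> x) * (u \<bullet> y))"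
  using arg_cong[OF orthonormal_basis_sum[of x], of "\<lambda>z. z \<bullet> y"] by (simp add: inner_sum_left)

lemma orthonormal_basis_norm_sum: "(norm x)\<^sup>2 = (\<Sum>u\<in>U. (u \<bullet> x)\<^sup>2)"
  using orthonormal_basis_inner_sum[of x x] by (simp add: power2_norm_eq_inner flip: power2_eq_square)

lemma orthonormal_basis_linear_eqI:
  assumes "linear S" "linear T" "\<And>u. u \<in> U \<Longrightarrow> S u = T u"
  shows "S x = T x"
  using linear_eq_on_span[of S T U] assms U by (auto simp: orthonormal_basis_def)

lemma orthonormal_basis_linear_expand:
  assumes "linear T"
  shows "T x = (\<Sum>u\<in>U. (u \<bullet> x) *\<^sub>R T u)"
  using arg_cong[OF orthonormal_basis_sum[of x], of T]
  by (simp add: linear_sum[OF assms] linear_cmul[OF assms])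

lemma eigenbasis_bilinear_form:
  assumes "linear T" "\<And>u. u \<in> U \<Longrightarrow> T u = \<mu> u *\<^sub>R u"
  shows "T x \<bullet> y = (\<Sum>u\<in>U. \<mu> u * (u \<bullet> x) * (u \<bullet> y))"
  using arg_cong[OF orthonormal_basis_linear_expand[OF assms(1), of x], of "\<lambda>z. z \<bullet> y"]
  by (simp add: assms(2) inner_sum_left mult_ac)

lemma eigenbasis_quadratic_form:
  assumes "linear T" "\<And>u. u \<in> U \<Longrightarrow> T u = \<mu> u *\<^sub>R u"
  shows "x \<bullet> T x = (\<Sum>u\<in>U. \<mu> u * (u \<bullet> x)\<^sup>2)"
  using eigenbasis_bilinear_form[OF assms, of x x] inner_commute[of x "T x"]
  by (simp add: power2_eq_square mult.assoc)

lemma eigenbasis_nonneg: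
  assumes "\<And>x. 0 \<le> x \<bullet> T x" "u \<in> U" "T u = \<mu> *\<^sub>R u"
  shows "0 \<le> \<mu>"
  using assms(1)[of u] assms(2,3) orthonormal_basis_inner[of u u] by simp

text \<open>An eigenvector for \<open>c\<close> has no component along basis vectors with another
  eigenvalue. This turns the multiplicities in \<open>singular_values\<close>, given as dimensions,
  into counts of basis vectors.\<close>

lemma eigenbasis_dim_eigenspace:
  assumes T: "linear T" and eig: "\<And>u. u \<in> U \<Longrightarrow> T u = \<mu> u *\<^sub>R u"
  shows "dim {x. T x = c *\<^sub>R x} = card {u \<in> U. \<mu> u = c}"
proof -
  let ?B = "{u \<in> U. \<mu> u = c}"
  have "{x. T x = c *\<^sub>R x} = span ?B"
  proof
    show "{x. T x = c *\<^sub>R x} \<subseteq> span ?B"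
    proof clarify
      fix x assume x: "T x = c *\<^sub>R x"
      have "u \<bullet> x = 0" if u: "u \<in> U" "\<mu> u \<noteq> c" for u
      proof -
        have "u \<bullet> T x = \<mu> u * (u \<bullet> x)"
          by (subst orthonormal_basis_linear_expand[OF T])
            (use u(1) orthonormal_basis_finite in \<open>simp add: eig inner_sum_right orthonormal_basis_inner
               if_distrib sum.delta' cong: if_cong sum.cong\<close>)
        then show ?thesis
          using x u(2) by simp
      qed
      then have "(\<Sum>u\<in>U. (u \<bullet> x) *\<^sub>R u) = (\<Sum>u\<in>?B. (u \<bullet> x) *\<^sub>R u)"
        using orthonormal_basis_finite by (intro sum.mono_neutral_right) auto
      also have "\<dots> \<in> span ?B"
        by (intro span_sum span_scale span_base)
      finally show "x \<in> span ?B"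
        by (simp only: orthonormal_basis_sum)
    qed
    show "span ?B \<subseteq> {x. T x = c *\<^sub>R x}"
      by (rule span_minimal)
        (auto simp: eig subspace_def linear_0[OF T] linear_add[OF T] linear_cmul[OF T] algebra_simps)
  qed
  then have "dim {x. T x = c *\<^sub>R x} = dim ?B"
    by simp
  also have "\<dots> = card ?B"
    using orthonormal_basis_independent
    by (intro dim_eq_card_independent) (rule independent_mono, auto)
  finally show ?thesis .
qed

end

text \<open>In an eigenbasis, \<open>b\<close> collects the coordinates with eigenvalue zero and
  \<open>a\<close> the others, while \<open>\<delta>\<close> bounds the positive eigenvalues from
  below.\<close>

lemma psd_spectral_gap:
  fixes T :: "'a::euclidean_space \<Rightarrow> 'a"
  assumes T: "linear T" and sa: "\<And>x y. T x \<bullet> y = x \<bullet> T y" and psd: "\<And>x. 0 \<le> x \<bullet> T x"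
  obtains \<delta> where "\<delta> > 0" "\<And>x. \<exists>a b. x = a + b \<and> T b = 0 \<and> a \<bullet> b = 0 \<and> \<delta> * (norm a)\<^sup>2 \<le> x \<bullet> T x"
proof -
  obtain U \<mu> where U: "orthonormal_basis U" and eig: "\<And>u. u \<in> U \<Longrightarrow> T u = \<mu> u *\<^sub>R u"
    using selfadjoint_eigenbasis[OF T sa] by metis
  note fin = orthonormal_basis_finite[OF U]
  have \<mu>: "0 \<le> \<mu> u" if "u \<in> U" for u
    using eigenbasis_nonneg[OF U psd that eig[OF that]] .
  \<comment> \<open>The inserted \<open>1\<close> keeps the set nonempty when
    \<open>T = 0\<close>.\<close>
  define \<delta> where "\<delta> = Min (insert 1 (\<mu> ` {u \<in> U. \<mu> u \<noteq> 0}))"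
  have "\<delta> > 0"
    unfolding \<delta>_def using fin \<mu> by (subst Min_gr_iff) (auto simp: less_le)
  have \<delta>: "\<delta> \<le> \<mu> u" if "u \<in> U" "\<mu> u \<noteq> 0" for u
    unfolding \<delta>_def using fin that by (intro Min_le) auto
  have "\<exists>a b. x = a + b \<and> T b = 0 \<and> a \<bullet> b = 0 \<and> \<delta> * (norm a)\<^sup>2 \<le> x \<bullet> T x" for x
  proof -
    define a where "a = (\<Sum>u\<in>{u\<in>U. \<mu> u \<noteq> 0}. (u \<bullet> x) *\<^sub>R u)"
    define b where "b = (\<Sum>u\<in>{u\<in>U. \<mu> u = 0}. (u \<bullet> x) *\<^sub>R u)"
    have "a + b = (\<Sum>u\<in>{u\<in>U. \<mu> u \<noteq> 0} \<union> {u\<in>U. \<mu> u = 0}. (u \<bullet> x) *\<^sub>R u)"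
      unfolding a_def b_def using fin by (subst sum.union_disjoint) auto
    also have "{u\<in>U. \<mu> u \<noteq> 0} \<union> {u\<in>U. \<mu> u = 0} = U"
      by auto
    finally have ab: "x = a + b"
      by (simp add: orthonormal_basis_sum[OF U])
    have Tb: "T b = 0"
      unfolding b_def by (simp add: linear_sum[OF T] linear_cmul[OF T] eig)
    have ua: "u \<bullet> a = (if \<mu> u = 0 then 0 else u \<bullet> x)" if "u \<in> U" for u
    proof -
      have "u \<bullet> a = (\<Sum>v\<in>{v\<in>U. \<mu> v \<noteq> 0}. if v = u then u \<bullet> x else 0)"
        unfolding a_def inner_sum_right using that
        by (intro sum.cong) (auto simp: orthonormal_basis_inner[OF U])
      then show ?thesis
        using fin that by (simp add: sum.delta')
    qed
    have "a \<bullet> b = 0"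
      unfolding b_def inner_sum_right using ua by (intro sum.neutral) (auto simp: inner_commute)
    moreover have "\<delta> * (norm a)\<^sup>2 \<le> (\<Sum>u\<in>U. \<mu> u * (u \<bullet> x)\<^sup>2)"
      unfolding orthonormal_basis_norm_sum[OF U] sum_distrib_left
      by (intro sum_mono) (auto simp: ua intro!: mult_right_mono \<delta>)
    moreover have "x \<bullet> T x = (\<Sum>u\<in>U. \<mu> u * (u \<bullet> x)\<^sup>2)"
      by (rule eigenbasis_quadratic_form[OF U T eig])
    ultimately show ?thesis
      using ab Tb by (intro exI[of _ a] exI[of _ b]) simp
  qed
  then show thesis
    using that \<open>\<delta> > 0\<close> by blast
qed

section \<open>Duality between the nuclear and the spectral norm\<close>

lemma linear_vector_matrix_mult: "linear (\<lambda>x. x v* (A :: real^'n^'m))"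
  using matrix_vector_mul_linear[of "transpose A"] by simp

lemma continuous_on_vector_matrix_mult_left: "continuous_on S (\<lambda>A. x v* (A :: real^'n^'m))"
  unfolding vector_matrix_mult_def by (intro continuous_intros)

lemma tendsto_vector_matrix_mult_left:
  fixes A :: "'a \<Rightarrow> real^'n^'m"
  assumes "(A \<longlongrightarrow> B) F"
  shows "((\<lambda>k. x v* A k) \<longlongrightarrow> x v* B) F"
  unfolding vector_matrix_mult_def by (intro tendsto_intros assms)

lemma vector_matrix_mult_add: "x v* (A + B) = x v* A + x v* (B :: real^'n^'m)"
  by (simp add: vec_eq_iff vector_matrix_mult_def algebra_simps sum.distrib)

lemma vector_matrix_mult_scaleR: "x v* (c *\<^sub>R A) = c *\<^sub>R (x v* (A :: real^'n^'m))"
  by (simp add: vec_eq_iff vector_matrix_mult_def algebra_simps sum_distrib_left)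

text \<open>The matrices \<open>u u^T\<close> sum to the identity, which is \<open>delta\<close>;
  inserting this sum between \<open>X^T\<close> and \<open>Y\<close> in the trace gives the
  formula.\<close>

lemma inner_matrix_orthonormal_basis:
  fixes X Y :: "real^'n^'m"
  assumes "orthonormal_basis U"
  shows "X \<bullet> Y = (\<Sum>u\<in>U. (u v* X) \<bullet> (u v* Y))"
proof -
  have e: "u v* Z = (\<Sum>i\<in>UNIV. (u $ i) *\<^sub>R (Z $ i))" for Z :: "real^'n^'m" and u
    by (simp add: vec_eq_iff vector_matrix_mult_def mult.commute)
  have delta: "(\<Sum>u\<in>U. u $ i * u $ j) = (if j = i then 1 else 0)" for i j
  proof -
    have "(\<Sum>u\<in>U. u $ i * u $ j) = axis i (1::real) \<bullet> axis j 1"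
      unfolding orthonormal_basis_inner_sum[OF assms, of "axis i 1" "axis j 1"]
      by (intro sum.cong) (simp_all only: inner_axis inner_real_def mult_1_right)
    then show ?thesis
      by (auto simp: inner_axis_axis)
  qed
  have "(\<Sum>u\<in>U. (u v* X) \<bullet> (u v* Y)) = (\<Sum>u\<in>U. \<Sum>i\<in>UNIV. \<Sum>j\<in>UNIV. (u $ i) * (u $ j) * (X $ j \<bullet> Y $ i))"
    unfolding e inner_sum_left inner_sum_right by (simp add: sum_distrib_left mult_ac)
  also have "\<dots> = (\<Sum>i\<in>UNIV. \<Sum>j\<in>UNIV. \<Sum>u\<in>U. (u $ i) * (u $ j) * (X $ j \<bullet> Y $ i))"
    by (subst sum.swap) (subst (2) sum.swap, rule refl)
  also have "\<dots> = (\<Sum>i\<in>UNIV. \<Sum>j\<in>UNIV. (\<Sum>u\<in>U. u $ i * u $ j) * (X $ j \<bullet> Y $ i))"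
    by (simp add: sum_distrib_right)
  also have "\<dots> = (\<Sum>i\<in>UNIV. \<Sum>j\<in>UNIV. if j = i then X $ i \<bullet> Y $ i else 0)"
    by (intro sum.cong) (auto simp: delta)
  also have "\<dots> = X \<bullet> Y"
    by (simp add: inner_vec_def)
  finally show ?thesis by simp
qed

definition outer :: "real^'m \<Rightarrow> real^'n \<Rightarrow> real^'n^'m" where
  "outer u v = (\<chi> i j. u $ i * v $ j)"

lemma vector_matrix_mult_outer: "x v* outer u v = (x \<bullet> u) *\<^sub>R v"
  by (simp add: vec_eq_iff vector_matrix_mult_def outer_def inner_vec_def sum_distrib_left mult_ac)

lemma inner_outer: "outer u v \<bullet> Z = (u v* Z) \<bullet> v"
  unfolding dot_lmul_matrix
  by (simp add: inner_vec_def outer_def matrix_vector_mult_def sum_distrib_left mult_ac)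

lemma norm_outer: "norm (outer u v) = norm u * norm v"
proof -
  have "outer u v \<bullet> outer u v = (norm u * norm v)\<^sup>2"
    by (simp add: inner_outer vector_matrix_mult_outer power_mult_distrib power2_norm_eq_inner)
  then show ?thesis
    by (simp add: norm_eq_sqrt_inner)
qed

lemma outer_diff_right: "outer u (v - w) = outer u v - outer u w"
  and outer_diff_left: "outer (u - u') v = outer u v - outer u' v"
  and outer_scaleR_right: "outer u (c *\<^sub>R v) = c *\<^sub>R outer u v"
  by (simp_all add: vec_eq_iff outer_def algebra_simps)

lemma sum_outer_orthonormal_basis:
  assumes "orthonormal_basis U"
  shows "(\<Sum>u\<in>U. outer u (u v* X)) = X"
proof -
  have "(\<Sum>u\<in>U. outer u (u v* X)) \<bullet> Z = X \<bullet> Z" for Z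
    unfolding inner_matrix_orthonormal_basis[OF assms, of X Z] inner_sum_left inner_outer
    by (simp add: inner_commute)
  then show ?thesis
    using vector_eq_rdot by blast
qed

section \<open>Contractions\<close>

lemma mem_spectral_ball_iff: "Z \<in> spectral_ball \<longleftrightarrow> (\<forall>v. norm (Z *v v) \<le> norm v)"
  unfolding spectral_ball_def spectral_norm_def mem_Collect_eq
proof safe
  fix v
  assume "onorm ((*v) Z) \<le> 1"
  then show "norm (Z *v v) \<le> norm v"
    using onorm[OF matrix_vector_mul_bounded_linear[of Z], of v]
    by (metis mult_right_mono norm_ge_zero mult_1 order_trans)
next
  assume "\<forall>v. norm (Z *v v) \<le> norm v"
  then show "onorm ((*v) Z) \<le> 1"
    by (intro onorm_le) simp
qed

text \<open>A matrix and its transpose have the same operator norm: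
  \<open>|Z^T u|^2 = u \<bullet> Z Z^T u \<le> |u| |Z^T u|\<close>, and one factor cancels.\<close>

lemma mem_spectral_ball_iff': "Z \<in> spectral_ball \<longleftrightarrow> (\<forall>u. norm (u v* Z) \<le> norm u)"
proof
  assume Z: "Z \<in> spectral_ball"
  show "\<forall>u. norm (u v* Z) \<le> norm u"
  proof
    fix u
    have "norm (u v* Z) * norm (u v* Z) = u \<bullet> (Z *v (u v* Z))"
      by (metis dot_lmul_matrix power2_norm_eq_inner power2_eq_square)
    also have "\<dots> \<le> norm u * norm (Z *v (u v* Z))"
      by (rule norm_cauchy_schwarz)
    also have "\<dots> \<le> norm u * norm (u v* Z)"
      using Z by (intro mult_left_mono) (auto simp: mem_spectral_ball_iff)
    finally show "norm (u v* Z) \<le> norm u"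
      by (metis mult_le_cancel_right norm_ge_zero norm_le_zero_iff not_less order_antisym)
  qed
next
  assume Z: "\<forall>u. norm (u v* Z) \<le> norm u"
  show "Z \<in> spectral_ball"
    unfolding mem_spectral_ball_iff
  proof
    fix v
    have "norm (Z *v v) * norm (Z *v v) = ((Z *v v) v* Z) \<bullet> v"
      by (metis dot_lmul_matrix power2_norm_eq_inner power2_eq_square)
    also have "\<dots> \<le> norm ((Z *v v) v* Z) * norm v"
      by (rule norm_cauchy_schwarz)
    also have "\<dots> \<le> norm (Z *v v) * norm v"
      using Z by (intro mult_right_mono) auto
    finally show "norm (Z *v v) \<le> norm v"
      by (metis mult_le_cancel_left norm_ge_zero norm_le_zero_iff not_less order_antisym)
  qed
qed

section \<open>Singular values from an eigenbasis of \<open>A A^T\<close>\<close>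

lemma gram_eigenspace: "eigenspace (A ** transpose A) c = {x. A *v (x v* A) = c *\<^sub>R x}"
  by (simp add: eigenspace_def flip: matrix_vector_mul_assoc)

lemma gram_selfadjoint: "(A *v (x v* (A :: real^'n^'m))) \<bullet> y = x \<bullet> (A *v (y v* A))"
  by (metis dot_lmul_matrix inner_commute)

lemma linear_gram: "linear (\<lambda>x. A *v (x v* (B :: real^'n^'m)))"
  using linear_compose[OF linear_vector_matrix_mult[of B] matrix_vector_mul_linear[of A]]
  by (simp add: o_def)

text \<open>\<open>U\<close> consists of left singular vectors, and \<open>norm (u v* A)\<close> is
  the singular value at \<open>u\<close>. Everything later about \<open>nuclear_norm\<close> rests
  on this sum rather than on the multiset.\<close>

lemma singular_basis:
  fixes A :: "real^'n^'m"
  obtains U where "orthonormal_basis U" "\<And>u. u \<in> U \<Longrightarrow> A *v (u v* A) = (norm (u v* A))\<^sup>2 *\<^sub>R u"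
    "nuclear_norm A = (\<Sum>u\<in>U. norm (u v* A))"
proof -
  define T where "T = (\<lambda>x. A *v (x v* A))"
  have T: "linear T"
    unfolding T_def by (rule linear_gram)
  obtain U \<mu> where U: "orthonormal_basis U" and eig: "\<And>u. u \<in> U \<Longrightarrow> T u = \<mu> u *\<^sub>R u"
    using selfadjoint_eigenbasis[OF T] gram_selfadjoint unfolding T_def by metis
  have \<mu>: "\<mu> u = (norm (u v* A))\<^sup>2" if "u \<in> U" for u
  proof -
    have "(norm (u v* A))\<^sup>2 = u \<bullet> T u"
      by (simp add: T_def power2_norm_eq_inner dot_lmul_matrix)
    then show ?thesis
      using eig[OF that] orthonormal_basis_inner[OF U that that] by simp
  qed
  have fin: "finite U"
    using U by (rule orthonormal_basis_finite)
  let ?S = "{s. 0 \<le> s \<and> (\<exists>v. v \<noteq> 0 \<and> v \<in> eigenspace (A ** transpose A) (s\<^sup>2))}"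
  let ?g = "\<lambda>u. norm (u v* A)"
  have dim: "dim (eigenspace (A ** transpose A) (s\<^sup>2)) = card {u \<in> U. ?g u = s}" if "0 \<le> s" for s
  proof -
    have "dim (eigenspace (A ** transpose A) (s\<^sup>2)) = card {u \<in> U. \<mu> u = s\<^sup>2}"
      unfolding gram_eigenspace using eigenbasis_dim_eigenspace[OF U T eig] by (simp add: T_def)
    also have "{u \<in> U. \<mu> u = s\<^sup>2} = {u \<in> U. ?g u = s}"
      using that \<mu> by auto
    finally show ?thesis .
  qed
  have img: "?g ` U \<subseteq> ?S"
  proof clarify
    fix u assume u: "u \<in> U"
    then have "u \<noteq> 0"
      using orthonormal_basis_norm[OF U u] by auto
    moreover have "u \<in> eigenspace (A ** transpose A) ((?g u)\<^sup>2)"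
      using eig[OF u] \<mu>[OF u] by (simp add: gram_eigenspace T_def)
    ultimately show "0 \<le> ?g u \<and> (\<exists>v. v \<noteq> 0 \<and> v \<in> eigenspace (A ** transpose A) ((?g u)\<^sup>2))"
      by auto
  qed
  have "sum_mset (\<Sum>s\<in>S. replicate_mset (d s) s) = (\<Sum>s\<in>S. of_nat (d s) * s)"
    if "finite S" for S :: "real set" and d
    using that by induction (auto simp: sum_mset_replicate_mset)
  from this[OF finite_singular_values[of A]]
  have "nuclear_norm A = (\<Sum>s\<in>?S. of_nat (dim (eigenspace (A ** transpose A) (s\<^sup>2))) * s)"
    unfolding nuclear_norm_def singular_values_def .
  also have "\<dots> = (\<Sum>s\<in>?S. \<Sum>u\<in>{u \<in> U. ?g u = s}. ?g u)"
    by (intro sum.cong) (auto simp: dim)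
  also have "\<dots> = (\<Sum>u\<in>U. ?g u)"
    using finite_singular_values img fin by (intro sum.group) auto
  finally show thesis
    using that[OF U] eig \<mu> by (auto simp: T_def)
qed

lemma num_unit_singular_values_eq_dim:
  "num_unit_singular_values Y = dim {x. Y *v (x v* Y) = x}"
proof -
  let ?S = "{s. 0 \<le> s \<and> (\<exists>v. v \<noteq> 0 \<and> v \<in> eigenspace (Y ** transpose Y) (s\<^sup>2))}"
  let ?d = "\<lambda>s. dim (eigenspace (Y ** transpose Y) (s\<^sup>2))"
  have "count (\<Sum>s\<in>?S. replicate_mset (?d s) s) 1 = (\<Sum>s\<in>?S. if s = 1 then ?d 1 else 0)"
    unfolding count_sum by (intro sum.cong) auto
  also have "\<dots> = (if 1 \<in> ?S then ?d 1 else 0)"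
    using finite_singular_values[of Y] by (simp add: sum.delta')
  also have "\<dots> = ?d 1"
  proof (cases "1 \<in> ?S")
    \<comment> \<open>If \<open>1\<close> is not a singular value, its eigenspace is trivial, so
      both cases yield the dimension.\<close>
    case False
    then have "eigenspace (Y ** transpose Y) (1\<^sup>2) \<subseteq> {0}"
      by auto
    then have "?d 1 = 0"
      by (subst dim_eq_0)
    then show ?thesis
      using False by simp
  qed simp
  finally show ?thesis
    unfolding num_unit_singular_values_def singular_values_def by (simp add: gram_eigenspace)
qed

section \<open>The nuclear norm as support function of the spectral ball\<close>

text \<open>Cauchy-Schwarz along the left singular vectors of \<open>X\<close>: each term is at most
  \<open>norm (u v* X)\<close> because \<open>Z^T\<close> is a contraction.\<close>

lemma inner_le_nuclear_norm:
  assumes "Z \<in> spectral_ball"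
  shows "X \<bullet> Z \<le> nuclear_norm X"
proof -
  obtain U where U: "orthonormal_basis U" "nuclear_norm X = (\<Sum>u\<in>U. norm (u v* X))"
    using singular_basis by metis
  have "(u v* X) \<bullet> (u v* Z) \<le> norm (u v* X)" if "u \<in> U" for u
  proof -
    have "norm (u v* Z) \<le> 1"
      using assms orthonormal_basis_norm[OF U(1) that] by (metis mem_spectral_ball_iff')
    then have "norm (u v* X) * norm (u v* Z) \<le> norm (u v* X)"
      by (simp add: mult_left_le)
    then show ?thesis
      using norm_cauchy_schwarz order_trans by blast
  qed
  then show ?thesis
    unfolding inner_matrix_orthonormal_basis[OF U(1)] U(2) by (rule sum_mono)
qed

text \<open>The maximiser is the polar factor of \<open>X\<close>, the sum of \<open>u v^T\<close>
  over the singular pairs with nonzero singular value.\<close>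

lemma nuclear_norm_attained:
  fixes X :: "real^'n^'m"
  obtains Z where "Z \<in> spectral_ball" "X \<bullet> Z = nuclear_norm X"
proof -
  obtain U where U: "orthonormal_basis U"
    and eig: "\<And>u. u \<in> U \<Longrightarrow> X *v (u v* X) = (norm (u v* X))\<^sup>2 *\<^sub>R u"
    and f: "nuclear_norm X = (\<Sum>u\<in>U. norm (u v* X))"
    using singular_basis[of X] by metis
  note fin = orthonormal_basis_finite[OF U]
  \<comment> \<open>The right singular vectors; \<open>sgn 0 = 0\<close> drops the pairs with
    singular value zero, so the \<open>s u\<close> are orthogonal and of norm one or zero.\<close>
  define s where "s u = sgn (u v* X)" for u
  define Z where "Z = (\<Sum>u\<in>U. outer u (s u))"
  have xZ: "x v* Z = (\<Sum>u\<in>U. (x \<bullet> u) *\<^sub>R s u)" for x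
    unfolding Z_def using fin
    by induction (auto simp: vector_matrix_mult_add vector_matrix_mult_outer)
  have ortho: "s u \<bullet> s v = 0" if "u \<in> U" "v \<in> U" "u \<noteq> v" for u v
  proof -
    have "(u v* X) \<bullet> (v v* X) = u \<bullet> (X *v (v v* X))"
      by (simp add: dot_lmul_matrix)
    also have "\<dots> = 0"
      using that by (simp add: eig orthonormal_basis_inner[OF U])
    finally show ?thesis
      by (simp add: s_def sgn_div_norm)
  qed
  have "norm (x v* Z) \<le> norm x" for x
  proof -
    have "(norm (x v* Z))\<^sup>2 = (\<Sum>u\<in>U. (norm ((x \<bullet> u) *\<^sub>R s u))\<^sup>2)"
      unfolding xZ using fin ortho
      by (intro norm_sum_Pythagorean) (auto simp: pairwise_def orthogonal_def)
    also have "\<dots> \<le> (\<Sum>u\<in>U. (u \<bullet> x)\<^sup>2)"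
      by (intro sum_mono) (auto simp: s_def norm_sgn inner_commute power_mult_distrib)
    also have "\<dots> = (norm x)\<^sup>2"
      by (simp add: orthonormal_basis_norm_sum[OF U])
    finally show ?thesis
      by (simp add: power2_le_iff_abs_le)
  qed
  then have Z: "Z \<in> spectral_ball"
    by (simp add: mem_spectral_ball_iff')
  have "u v* Z = s u" if "u \<in> U" for u
  proof -
    have "u v* Z = (\<Sum>v\<in>U. if v = u then s u else 0)"
      unfolding xZ using that by (intro sum.cong) (auto simp: orthonormal_basis_inner[OF U])
    then show ?thesis
      using fin that by (simp add: sum.delta')
  qed
  moreover have "x \<bullet> sgn x = norm x" for x :: "real^'n"
    by (cases "x = 0") (simp_all add: sgn_div_norm power2_eq_square flip: power2_norm_eq_inner)
  ultimately have "X \<bullet> Z = (\<Sum>u\<in>U. norm (u v* X))"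
    unfolding inner_matrix_orthonormal_basis[OF U] by (intro sum.cong) (auto simp: s_def)
  then show thesis
    using Z f that by simp
qed

lemma nuclear_norm_triangle: "nuclear_norm (X + Y) \<le> nuclear_norm X + nuclear_norm Y"
proof -
  obtain Z where "Z \<in> spectral_ball" "(X + Y) \<bullet> Z = nuclear_norm (X + Y)"
    using nuclear_norm_attained by metis
  then show ?thesis
    using inner_le_nuclear_norm[of Z X] inner_le_nuclear_norm[of Z Y] by (simp add: inner_simps)
qed

lemma zero_in_spectral_ball: "0 \<in> spectral_ball"
  by (simp add: mem_spectral_ball_iff)

lemma nuclear_norm_zero: "nuclear_norm 0 = 0"
  by (metis nuclear_norm_attained inner_zero_left)

lemma nuclear_norm_nonneg: "0 \<le> nuclear_norm X"
  using inner_le_nuclear_norm[OF zero_in_spectral_ball, of X] by simp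

lemma nuclear_norm_outer_le: "nuclear_norm (outer u v) \<le> norm u * norm v"
proof -
  obtain Z where Z: "Z \<in> spectral_ball" "outer u v \<bullet> Z = nuclear_norm (outer u v)"
    using nuclear_norm_attained by metis
  have "(u v* Z) \<bullet> v \<le> norm (u v* Z) * norm v"
    by (rule norm_cauchy_schwarz)
  also have "\<dots> \<le> norm u * norm v"
    using Z(1) by (intro mult_right_mono) (auto simp: mem_spectral_ball_iff')
  finally show ?thesis
    using Z(2) by (simp add: inner_outer)
qed

text \<open>The subdifferential of a support function at \<open>X\<close> is the face of the set on
  which \<open>X\<close> attains its maximum.\<close>

lemma subdifferential_nuclear_norm:
  "subdifferential nuclear_norm X = {Y \<in> spectral_ball. X \<bullet> Y = nuclear_norm X}"
proof (intro equalityI subsetI)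
  fix Y assume "Y \<in> subdifferential nuclear_norm X"
  then have Y: "nuclear_norm Z \<ge> nuclear_norm X + Y \<bullet> (Z - X)" for Z
    by (simp add: subdifferential_def)
  \<comment> \<open>The subgradient inequality at \<open>X + Z\<close>, combined with subadditivity,
    no longer involves \<open>X\<close>.\<close>
  have le: "Y \<bullet> Z \<le> nuclear_norm Z" for Z
    using Y[of "X + Z"] nuclear_norm_triangle[of X Z] by simp
  have "norm (Y *v v) \<le> norm v" for v
  proof -
    \<comment> \<open>Testing against the outer product of \<open>Y v\<close> and \<open>v\<close>
      turns the nuclear norm bound into an operator norm bound.\<close>
    have "norm (Y *v v) * norm (Y *v v) = Y \<bullet> outer (Y *v v) v"
      by (simp add: inner_commute[of Y] inner_outer dot_lmul_matrix
          flip: power2_norm_eq_inner power2_eq_square)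
    also have "\<dots> \<le> norm (Y *v v) * norm v"
      using le nuclear_norm_outer_le order_trans by blast
    finally show ?thesis
      by (metis mult_le_cancel_left norm_ge_zero norm_le_zero_iff not_less order_antisym)
  qed
  then have "Y \<in> spectral_ball"
    by (simp add: mem_spectral_ball_iff)
  moreover have "X \<bullet> Y = nuclear_norm X"
    using le[of X] Y[of 0] by (simp add: nuclear_norm_zero inner_commute)
  ultimately show "Y \<in> {Y \<in> spectral_ball. X \<bullet> Y = nuclear_norm X}"
    by simp
next
  fix Y assume Y: "Y \<in> {Y \<in> spectral_ball. X \<bullet> Y = nuclear_norm X}"
  have "nuclear_norm X + Y \<bullet> (Z - X) \<le> nuclear_norm Z" for Z
    using Y inner_le_nuclear_norm[of Y Z] by (simp add: inner_diff_right inner_commute)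
  then show "Y \<in> subdifferential nuclear_norm X"
    by (simp add: subdifferential_def)
qed

text \<open>Normality at \<open>Y\<close> means that \<open>Y\<close> maximises
  \<open>X \<bullet> Z\<close> over the ball, and that maximum is the nuclear norm.\<close>

lemma mem_normal_cone_spectral_ball_iff:
  assumes "Y \<in> spectral_ball"
  shows "X \<in> normal_cone spectral_ball Y \<longleftrightarrow> X \<bullet> Y = nuclear_norm X"
proof
  assume "X \<in> normal_cone spectral_ball Y"
  moreover obtain Z where "Z \<in> spectral_ball" "X \<bullet> Z = nuclear_norm X"
    using nuclear_norm_attained by metis
  ultimately have "nuclear_norm X \<le> X \<bullet> Y"
    by (auto simp: normal_cone_def inner_diff_right)
  then show "X \<bullet> Y = nuclear_norm X"
    using inner_le_nuclear_norm[OF assms, of X] by simp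
next
  assume "X \<bullet> Y = nuclear_norm X"
  then show "X \<in> normal_cone spectral_ball Y"
    by (simp add: normal_cone_def inner_diff_right inner_le_nuclear_norm)
qed

lemma compact_spectral_ball: "compact (spectral_ball :: (real^'n^'m) set)"
proof (rule compact_eq_bounded_closed[THEN iffD2, OF conjI])
  obtain U where U: "orthonormal_basis (U :: (real^'m) set)"
    using singular_basis[of "0 :: real^'n^'m"] by metis
  have "norm Z \<le> sqrt (card U)" if "Z \<in> spectral_ball" for Z :: "real^'n^'m"
  proof -
    have "(u v* Z) \<bullet> (u v* Z) \<le> 1" if "u \<in> U" for u
      using \<open>Z \<in> spectral_ball\<close> orthonormal_basis_norm[OF U that]
      by (metis mem_spectral_ball_iff' power2_norm_eq_inner power_le_one norm_ge_zero)
    then have "Z \<bullet> Z \<le> card U"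
      unfolding inner_matrix_orthonormal_basis[OF U] using sum_bounded_above[of U _ "1::real"] by simp
    then show ?thesis
      by (simp add: norm_eq_sqrt_inner)
  qed
  then show "bounded (spectral_ball :: (real^'n^'m) set)"
    by (auto simp: bounded_iff)
  have "(spectral_ball :: (real^'n^'m) set) = (\<Inter>u. {Z. norm (u v* Z) \<le> norm u})"
    by (auto simp: mem_spectral_ball_iff')
  also have "closed \<dots>"
    by (intro closed_INT ballI closed_Collect_le continuous_intros
        continuous_on_vector_matrix_mult_left)
  finally show "closed (spectral_ball :: (real^'n^'m) set)" .
qed

lemma convex_spectral_ball: "convex (spectral_ball :: (real^'n^'m) set)"
proof (rule convexI)
  fix X Y :: "real^'n^'m" and s t :: real
  assume XY: "X \<in> spectral_ball" "Y \<in> spectral_ball" and st: "0 \<le> s" "0 \<le> t" "s + t = 1"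
  have "norm (u v* (s *\<^sub>R X + t *\<^sub>R Y)) \<le> norm u" for u
  proof -
    have "norm (u v* (s *\<^sub>R X + t *\<^sub>R Y)) \<le> s * norm (u v* X) + t * norm (u v* Y)"
      unfolding vector_matrix_mult_add vector_matrix_mult_scaleR
      using norm_triangle_ineq[of "s *\<^sub>R (u v* X)" "t *\<^sub>R (u v* Y)"] st by simp
    also have "\<dots> \<le> s * norm u + t * norm u"
      using XY st by (intro add_mono mult_left_mono) (auto simp: mem_spectral_ball_iff')
    also have "\<dots> = norm u"
      using st by (simp flip: distrib_right)
    finally show ?thesis .
  qed
  then show "s *\<^sub>R X + t *\<^sub>R Y \<in> spectral_ball"
    by (simp add: mem_spectral_ball_iff')
qed

lemma compact_subdifferential_nuclear_norm: "compact (subdifferential nuclear_norm X)"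
proof -
  have "closed {Y. X \<bullet> Y = nuclear_norm X}"
    by (intro closed_Collect_eq continuous_intros)
  then have "compact (spectral_ball \<inter> {Y. X \<bullet> Y = nuclear_norm X})"
    using compact_spectral_ball by (rule compact_Int_closed[rotated])
  then show ?thesis
    by (simp add: subdifferential_nuclear_norm Int_def)
qed

lemma convex_subdifferential_nuclear_norm: "convex (subdifferential nuclear_norm X)"
proof -
  have "convex (spectral_ball \<inter> {Y. X \<bullet> Y = nuclear_norm X})"
    by (intro convex_Int convex_spectral_ball convex_hyperplane)
  then show ?thesis
    by (simp add: subdifferential_nuclear_norm Int_def)
qed

section \<open>Normal cones of the spectral ball\<close>

lemma unit_inner_eq_1_imp_eq:
  fixes p q :: "'a::real_inner"
  assumes "norm p \<le> 1" "norm q \<le> 1" "p \<bullet> q = 1"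
  shows "p = q"
proof -
  have "(norm (p - q))\<^sup>2 = (norm p)\<^sup>2 + (norm q)\<^sup>2 - 2"
    using assms(3) by (simp add: power2_norm_eq_inner inner_simps inner_commute[of q p])
  also have "\<dots> \<le> 0"
    using assms(1,2) by (smt (verit) norm_ge_zero power_le_one)
  finally show ?thesis
    by simp
qed

text \<open>If \<open>Y^T\<close> preserves the length of \<open>a\<close>, expanding
  \<open>|Y Y^T a - a|^2\<close> gives at most \<open>|a|^2 + |a|^2 - 2 |a|^2\<close>. So the fixed
  space of \<open>Y Y^T\<close> is where \<open>Y^T\<close> preserves length.\<close>

lemma spectral_ball_gram_fixed_iff:
  assumes "Y \<in> spectral_ball"
  shows "Y *v (a v* Y) = a \<longleftrightarrow> norm (a v* Y) = norm a"
proof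
  have eq: "(norm (a v* Y))\<^sup>2 = a \<bullet> (Y *v (a v* Y))"
    by (simp add: power2_norm_eq_inner dot_lmul_matrix)
  show "norm (a v* Y) = norm a" if "Y *v (a v* Y) = a"
    using eq that by (metis power2_norm_eq_inner norm_ge_zero power2_eq_iff_nonneg)
  assume n: "norm (a v* Y) = norm a"
  let ?c = "Y *v (a v* Y)"
  have "norm ?c \<le> norm a"
    using assms n by (metis mem_spectral_ball_iff)
  then have "(norm ?c)\<^sup>2 \<le> (norm a)\<^sup>2"
    by (intro power_mono) auto
  moreover have "(norm (?c - a))\<^sup>2 = (norm ?c)\<^sup>2 + (norm a)\<^sup>2 - 2 * (a \<bullet> ?c)"
    by (simp add: power2_norm_eq_inner inner_simps inner_commute[of ?c a])
  moreover have "a \<bullet> ?c = (norm a)\<^sup>2"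
    using eq n by simp
  ultimately have "(norm (?c - a))\<^sup>2 \<le> 0"
    by linarith
  then show "?c = a"
    by simp
qed

text \<open>Equality in the duality inequality forces equality in Cauchy-Schwarz for each
  \<open>u\<close>: \<open>Y^T\<close> sends every left singular vector of \<open>X\<close> with
  nonzero singular value to the matching right one.\<close>

lemma normal_cone_spectral_ball_singular_basis:
  assumes Y: "Y \<in> spectral_ball" and X: "X \<in> normal_cone spectral_ball Y"
    and U: "orthonormal_basis U" "nuclear_norm X = (\<Sum>u\<in>U. norm (u v* X))" and u: "u \<in> U"
  shows "u v* X = norm (u v* X) *\<^sub>R (u v* Y)" "Y *v (u v* X) = norm (u v* X) *\<^sub>R u"
proof -
  have uY: "norm (v v* Y) \<le> 1" if "v \<in> U" for v
    using Y orthonormal_basis_norm[OF U(1) that] by (metis mem_spectral_ball_iff')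
  have le: "(v v* X) \<bullet> (v v* Y) \<le> norm (v v* X)" if "v \<in> U" for v
    using uY[OF that] norm_cauchy_schwarz[of "v v* X" "v v* Y"] mult_left_le[of "norm (v v* Y)" "norm (v v* X)"]
    by simp
  have "(\<Sum>v\<in>U. norm (v v* X) - (v v* X) \<bullet> (v v* Y)) = 0"
    using X U(2) by (simp add: mem_normal_cone_spectral_ball_iff[OF Y] sum_subtractf
        inner_matrix_orthonormal_basis[OF U(1)])
  then have eq: "(u v* X) \<bullet> (u v* Y) = norm (u v* X)"
    using le u orthonormal_basis_finite[OF U(1)] by (subst (asm) sum_nonneg_eq_0_iff) auto
  show *: "u v* X = norm (u v* X) *\<^sub>R (u v* Y)"
  proof (cases "u v* X = 0")
    case False
    have "sgn (u v* X) \<bullet> (u v* Y) = 1"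
      using eq False by (simp add: sgn_div_norm)
    then have "sgn (u v* X) = u v* Y"
      using uY[OF u] by (intro unit_inner_eq_1_imp_eq[OF _ _ \<open>sgn (u v* X) \<bullet> (u v* Y) = 1\<close>]) (auto simp: norm_sgn)
    then show ?thesis
      using False by (simp add: sgn_div_norm flip: \<open>sgn (u v* X) = u v* Y\<close>)
  qed simp
  show "Y *v (u v* X) = norm (u v* X) *\<^sub>R u"
  proof (cases "u v* X = 0")
    case False
    then have "norm (u v* Y) = norm u"
      using arg_cong[OF *, of norm] orthonormal_basis_norm[OF U(1) u] by simp
    then have "Y *v (u v* Y) = u"
      using spectral_ball_gram_fixed_iff[OF Y] by blast
    then show ?thesis
      by (subst *) (simp only: matrix_vector_mult_scaleR)
  qed simp
qed

text \<open>In matrix terms: \<open>X Y\<^sup>T\<close> is symmetric positive semidefinite and \<open>X Y\<^sup>T Y = X\<close>.\<close>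

lemma mem_normal_cone_spectral_ball_iff_psd:
  assumes Y: "Y \<in> spectral_ball"
  shows "X \<in> normal_cone spectral_ball Y \<longleftrightarrow>
    (\<forall>a b. (Y *v (a v* X)) \<bullet> b = a \<bullet> (Y *v (b v* X))) \<and>
    (\<forall>a. 0 \<le> a \<bullet> (Y *v (a v* X))) \<and>
    (\<forall>a. (Y *v (a v* X)) v* Y = a v* X)" (is "_ \<longleftrightarrow> ?sym \<and> ?psd \<and> ?range")
proof (intro iffI; (elim conjE)?)
  assume X: "X \<in> normal_cone spectral_ball Y"
  obtain U where U: "orthonormal_basis U" "nuclear_norm X = (\<Sum>u\<in>U. norm (u v* X))"
    using singular_basis by metis
  note eig = normal_cone_spectral_ball_singular_basis[OF Y X U]
  note form = eigenbasis_bilinear_form[OF U(1) linear_gram, of Y X "\<lambda>u. norm (u v* X)", OF eig(2)]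
  have ?sym
    unfolding form by (subst (2) inner_commute) (simp add: form mult_ac)
  moreover have ?psd
    by (subst inner_commute) (simp add: form mult.assoc sum_nonneg)
  moreover have ?range
  proof
    fix a
    have "linear (\<lambda>a. (Y *v (a v* X)) v* Y)"
      using linear_compose[OF linear_gram linear_vector_matrix_mult] by (simp add: o_def)
    moreover have "(Y *v (u v* X)) v* Y = u v* X" if "u \<in> U" for u
      using eig[OF that] linear_cmul[OF linear_vector_matrix_mult[of Y]] by metis
    ultimately show "(Y *v (a v* X)) v* Y = a v* X"
      using orthonormal_basis_linear_eqI[OF U(1) _ linear_vector_matrix_mult] by blast
  qed
  ultimately show "?sym \<and> ?psd \<and> ?range"
    by blast
next
  assume sym: ?sym and psd: ?psd and rng: ?range
  \<comment> \<open>\<open>T\<close> is \<open>Y X^T\<close>. Along its eigenbasis the range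
    condition makes \<open>u v* X\<close> a nonnegative multiple of \<open>u v* Y\<close>, so
    \<open>Y\<close> maximises \<open>X \<bullet> Z\<close> term by term.\<close>
  define T where "T = (\<lambda>a. Y *v (a v* X))"
  have T: "linear T"
    unfolding T_def by (rule linear_gram)
  obtain U \<mu> where U: "orthonormal_basis U" and eig: "\<And>u. u \<in> U \<Longrightarrow> T u = \<mu> u *\<^sub>R u"
    using selfadjoint_eigenbasis[OF T] sym unfolding T_def by metis
  have n1: "norm (u v* Z) \<le> 1" if "u \<in> U" "Z \<in> spectral_ball" for u Z
    using that orthonormal_basis_norm[OF U] by (metis mem_spectral_ball_iff')
  have "X \<bullet> Z \<le> X \<bullet> Y" if Z: "Z \<in> spectral_ball" for Z
    unfolding inner_matrix_orthonormal_basis[OF U]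
  proof (rule sum_mono)
    fix u assume u: "u \<in> U"
    have \<mu>: "0 \<le> \<mu> u"
      using eigenbasis_nonneg[OF U, where T = T and u = u] psd u eig[OF u] unfolding T_def by blast
    have "u v* X = \<mu> u *\<^sub>R (u v* Y)"
      using rng eig[OF u] linear_cmul[OF linear_vector_matrix_mult[of Y]] unfolding T_def by metis
    then have "(u v* X) \<bullet> (u v* Z) = \<mu> u * ((u v* Y) \<bullet> (u v* Z))"
      by simp
    also have "\<dots> \<le> \<mu> u * 1"
    proof (intro mult_left_mono \<mu>)
      have "(u v* Y) \<bullet> (u v* Z) \<le> norm (u v* Y) * norm (u v* Z)"
        by (rule norm_cauchy_schwarz)
      also have "\<dots> \<le> 1 * 1"
        using n1[OF u] Y Z by (intro mult_mono) auto
      finally show "(u v* Y) \<bullet> (u v* Z) \<le> 1" by simp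
    qed
    also have "\<mu> u * 1 = T u \<bullet> u"
      using eig[OF u] orthonormal_basis_inner[OF U u u] by simp
    also have "\<dots> = (u v* X) \<bullet> (u v* Y)"
      unfolding T_def by (metis dot_lmul_matrix inner_commute)
    finally show "(u v* X) \<bullet> (u v* Z) \<le> (u v* X) \<bullet> (u v* Y)" .
  qed
  then show "X \<in> normal_cone spectral_ball Y"
    by (simp add: normal_cone_def inner_diff_right)
qed

text \<open>The characterisation of a normal \<open>X\<close> involves only the vectors
  \<open>Y X^T a\<close>, which are fixed by \<open>Y Y^T\<close>. There \<open>Y'\<close> acts like
  \<open>Y\<close>, so all three conditions carry over.\<close>

lemma normal_cone_spectral_ball_mono:
  assumes Y: "Y \<in> spectral_ball" and Y': "Y' \<in> spectral_ball"
    and fixed: "\<And>a. Y *v (a v* Y) = a \<Longrightarrow> a v* Y' = a v* Y \<and> Y' *v (a v* Y') = a"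
  shows "normal_cone spectral_ball Y \<subseteq> normal_cone spectral_ball Y'"
proof
  fix X assume X: "X \<in> normal_cone spectral_ball Y"
  have eq: "Y' *v (a v* X) = Y *v (a v* X) \<and> (Y *v (a v* X)) v* Y' = a v* X" for a
  proof -
    have "(Y *v (a v* X)) v* Y = a v* X"
      using X mem_normal_cone_spectral_ball_iff_psd[OF Y] by blast
    then show ?thesis
      using fixed[of "Y *v (a v* X)"] by metis
  qed
  show "X \<in> normal_cone spectral_ball Y'"
    using X unfolding mem_normal_cone_spectral_ball_iff_psd[OF Y] mem_normal_cone_spectral_ball_iff_psd[OF Y']
    by (simp add: eq)
qed

text \<open>\<open>M^T a\<close> has full length \<open>|a|\<close> although it is the midpoint of
  two vectors of length at most \<open>|a|\<close>; by the parallelogram law these coincide.\<close>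

lemma spectral_ball_midpoint_fixed:
  assumes Y: "Y \<in> spectral_ball" and Y': "Y' \<in> spectral_ball"
    and M: "M = (1/2) *\<^sub>R Y + (1/2) *\<^sub>R Y'" and a: "M *v (a v* M) = a"
  shows "a v* Y' = a v* Y" "Y *v (a v* Y) = a" "Y' *v (a v* Y') = a"
proof -
  have "M \<in> spectral_ball"
    unfolding M using convexD[OF convex_spectral_ball Y Y', of "1/2" "1/2"] by simp
  then have nM: "norm (a v* M) = norm a"
    using a by (simp add: spectral_ball_gram_fixed_iff)
  let ?p = "a v* Y" and ?q = "a v* Y'"
  have p: "norm ?p \<le> norm a" and q: "norm ?q \<le> norm a"
    using Y Y' by (auto simp: mem_spectral_ball_iff')
  have aM: "a v* M = (1/2) *\<^sub>R (?p + ?q)"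
    by (simp add: M vector_matrix_mult_add vector_matrix_mult_scaleR scaleR_add_right)
  have "norm (?p + ?q) = 2 * norm a"
    using nM unfolding aM by simp
  then have "(norm (?p + ?q))\<^sup>2 = 4 * (norm a)\<^sup>2"
    by (simp add: power_mult_distrib)
  moreover have "(norm (?p + ?q))\<^sup>2 + (norm (?p - ?q))\<^sup>2 = 2 * (norm ?p)\<^sup>2 + 2 * (norm ?q)\<^sup>2"
    by (simp add: power2_norm_eq_inner inner_simps)
  moreover have "(norm ?p)\<^sup>2 \<le> (norm a)\<^sup>2" "(norm ?q)\<^sup>2 \<le> (norm a)\<^sup>2"
    using p q by (auto intro: power_mono)
  ultimately have "(norm (?p - ?q))\<^sup>2 \<le> 0"
    by linarith
  then show pq: "?q = ?p"
    by simp
  then have "norm ?p = norm a"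
    using nM unfolding aM by (simp flip: scaleR_2)
  then show "Y *v (a v* Y) = a" "Y' *v (a v* Y') = a"
    using spectral_ball_gram_fixed_iff[OF Y, of a] spectral_ball_gram_fixed_iff[OF Y', of a] pq by simp_all
qed

text \<open>The fixed space of the midpoint lies in that of \<open>Y\<close>, and minimality of the
  dimension makes them equal. Hence \<open>Y^T\<close> and \<open>Y'^T\<close> agree on the fixed
  space of \<open>Y\<close>.\<close>

lemma normal_cone_minimal_unit_singular_values:
  assumes D: "convex D" "D \<subseteq> spectral_ball" and Y: "Y \<in> D" and Y': "Y' \<in> D"
    and min: "\<And>Z. Z \<in> D \<Longrightarrow> num_unit_singular_values Y \<le> num_unit_singular_values Z"
  shows "normal_cone spectral_ball Y \<subseteq> normal_cone spectral_ball Y'"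
proof (rule normal_cone_spectral_ball_mono)
  show Yb: "Y \<in> spectral_ball" and Yb': "Y' \<in> spectral_ball"
    using D Y Y' by auto
  define M where "M = (1/2) *\<^sub>R Y + (1/2) *\<^sub>R Y'"
  define E where "E Z = {x. Z *v (x v* Z) = x}" for Z :: "real^'a^'b"
  have sub: "subspace (E Z)" for Z
    unfolding E_def subspace_def
    by (simp add: linear_0[OF linear_gram] linear_add[OF linear_gram] linear_cmul[OF linear_gram])
  have "M \<in> D"
    unfolding M_def using convexD[OF D(1) Y Y', of "1/2" "1/2"] by simp
  from min[OF this] have "dim (E Y) \<le> dim (E M)"
    by (simp add: num_unit_singular_values_eq_dim E_def)
  moreover have "E M \<subseteq> E Y"
    using spectral_ball_midpoint_fixed(2)[OF Yb Yb' M_def] by (auto simp: E_def)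
  ultimately have "E M = E Y"
    by (intro subspace_dim_equal sub)
  then have "M *v (a v* M) = a" if "Y *v (a v* Y) = a" for a
    using that by (auto simp: E_def)
  then show "a v* Y' = a v* Y \<and> Y' *v (a v* Y') = a" if "Y *v (a v* Y) = a" for a
    using that spectral_ball_midpoint_fixed[OF Yb Yb' M_def] by blast
qed

text \<open>Supplies the approximants below. For \<open>b\<close> fixed by \<open>Y Y^T\<close>,
  Cauchy-Schwarz shows that \<open>Y\<close> maximises the inner product with
  \<open>b (Y^T b)^T\<close> over the ball, and nonnegative combinations keep this
  maximiser.\<close>

lemma outer_gram_in_normal_cone:
  assumes "finite U" "\<And>u. u \<in> U \<Longrightarrow> 0 \<le> c u" "\<And>u. u \<in> U \<Longrightarrow> Y *v (b u v* Y) = b u"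
    and Y: "Y \<in> spectral_ball"
  shows "(\<Sum>u\<in>U. c u *\<^sub>R outer (b u) (b u v* Y)) \<in> normal_cone spectral_ball Y"
proof -
  have "(\<Sum>u\<in>U. c u * ((b u v* Z) \<bullet> (b u v* Y))) \<le> (\<Sum>u\<in>U. c u * ((b u v* Y) \<bullet> (b u v* Y)))"
    if Z: "Z \<in> spectral_ball" for Z
  proof (intro sum_mono mult_left_mono assms(2))
    fix u assume "u \<in> U"
    then have n: "norm (b u v* Y) = norm (b u)"
      using assms(3) Y spectral_ball_gram_fixed_iff by blast
    have "(b u v* Z) \<bullet> (b u v* Y) \<le> norm (b u v* Z) * norm (b u v* Y)"
      by (rule norm_cauchy_schwarz)
    also have "\<dots> \<le> norm (b u v* Y) * norm (b u v* Y)"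
      using Z n by (intro mult_right_mono) (auto simp: mem_spectral_ball_iff')
    also have "\<dots> = (b u v* Y) \<bullet> (b u v* Y)"
      by (simp flip: power2_norm_eq_inner power2_eq_square)
    finally show "(b u v* Z) \<bullet> (b u v* Y) \<le> (b u v* Y) \<bullet> (b u v* Y)" .
  qed
  then show ?thesis
    by (simp add: normal_cone_def inner_diff_right inner_sum_left inner_outer)
qed

text \<open>The approximant \<open>X'\<close> replaces each singular pair \<open>(u, v)\<close> of \<open>X\<close> by \<open>(b, Y\<^sup>T b)\<close>, where \<open>b\<close> is the
  projection of \<open>u\<close> onto the fixed space of \<open>Y Y\<^sup>T\<close>.\<close>

lemma nuclear_norm_quadratic_growth:
  fixes Y :: "real^'n^'m"
  assumes Y: "Y \<in> spectral_ball"
  obtains C where "\<And>X. \<exists>X'\<in>normal_cone spectral_ball Y.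
    (norm (X - X'))\<^sup>2 \<le> C * nuclear_norm X * (nuclear_norm X - X \<bullet> Y)"
proof -
  \<comment> \<open>\<open>T\<close> is \<open>I - Y Y^T\<close>: its kernel is the fixed space and
    its form is the loss of squared length under \<open>Y^T\<close>, so the spectral gap bounds the
    distance to the fixed space by this loss.\<close>
  define T where "T = (\<lambda>x. x - Y *v (x v* Y))"
  have T: "linear T"
    unfolding T_def by (intro linear_compose_sub linear_gram linear_id[unfolded id_def])
  have quad: "x \<bullet> T x = (norm x)\<^sup>2 - (norm (x v* Y))\<^sup>2" for x
    by (simp add: T_def inner_diff_right power2_norm_eq_inner dot_lmul_matrix)
  have "T x \<bullet> y = x \<bullet> T y" for x y
    by (simp add: T_def inner_diff_left inner_diff_right gram_selfadjoint)
  moreover have "0 \<le> x \<bullet> T x" for x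
    using Y by (simp add: quad mem_spectral_ball_iff')
  ultimately obtain \<delta> where \<delta>: "\<delta> > 0"
    and gap: "\<And>x. \<exists>a b. x = a + b \<and> T b = 0 \<and> a \<bullet> b = 0 \<and> \<delta> * (norm a)\<^sup>2 \<le> x \<bullet> T x"
    using psd_spectral_gap[OF T] by metis
  \<comment> \<open>\<open>sqrt 2\<close> accounts for the error in the right singular vector, and
    each \<open>sqrt (2 / \<delta>)\<close> for one occurrence of the component \<open>a u\<close>
    off the fixed space.\<close>
  define K where "K = sqrt 2 + 2 * sqrt (2 / \<delta>)"
  have "\<exists>X'\<in>normal_cone spectral_ball Y.
      (norm (X - X'))\<^sup>2 \<le> K\<^sup>2 * nuclear_norm X * (nuclear_norm X - X \<bullet> Y)" for X
  proof -
    obtain U where U: "orthonormal_basis U" "nuclear_norm X = (\<Sum>u\<in>U. norm (u v* X))"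
      using singular_basis by metis
    obtain a b where ab: "\<And>x. x = a x + b x" "\<And>x. T (b x) = 0" "\<And>x. a x \<bullet> b x = 0"
      "\<And>x. \<delta> * (norm (a x))\<^sup>2 \<le> x \<bullet> T x"
      using gap by metis
    define \<sigma> where "\<sigma> u = norm (u v* X)" for u
    \<comment> \<open>The share of \<open>u\<close> in the gap
      \<open>nuclear_norm X - X \<bullet> Y\<close>; below, \<open>g\<close> is this share divided
      by \<open>\<sigma> u\<close>.\<close>
    define h where "h u = \<sigma> u - (u v* X) \<bullet> (u v* Y)" for u
    define X' where "X' = (\<Sum>u\<in>U. \<sigma> u *\<^sub>R outer (b u) (b u v* Y))"
    have X': "X' \<in> normal_cone spectral_ball Y"
      unfolding X'_def using ab(2) Y orthonormal_basis_finite[OF U(1)]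
      by (intro outer_gram_in_normal_cone) (auto simp: \<sigma>_def T_def)
    have h: "0 \<le> h u \<and> norm (outer u (u v* X) - \<sigma> u *\<^sub>R outer (b u) (b u v* Y)) \<le> K * (sqrt (\<sigma> u) * sqrt (h u))"
      if u: "u \<in> U" for u
    proof (cases "u v* X = 0")
      case False
      define s where "s = sgn (u v* X)"
      define g where "g = 1 - s \<bullet> (u v* Y)"
      have \<sigma>: "\<sigma> u > 0"
        using False by (simp add: \<sigma>_def)
      have s: "norm s = 1" "u v* X = \<sigma> u *\<^sub>R s"
        using False by (simp_all add: s_def \<sigma>_def norm_sgn sgn_div_norm)
      have hg: "h u = \<sigma> u * g"
        unfolding h_def g_def s(2) by (simp add: algebra_simps)
      have nu: "norm u = 1"
        using orthonormal_basis_norm[OF U(1) u] .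
      have le: "norm (x v* Y) \<le> norm x" for x
        using Y by (simp add: mem_spectral_ball_iff')
      have nY: "norm (u v* Y) \<le> 1"
        using le[of u] nu by simp
      have sY: "s \<bullet> (u v* Y) \<le> norm (u v* Y)"
        using norm_cauchy_schwarz[of s "u v* Y"] s(1) by simp
      have g: "0 \<le> g"
        using nY sY by (simp add: g_def)
      have n2: "(norm (u v* Y))\<^sup>2 \<le> 1"
        using nY by (simp add: power_le_one)
      have "(norm (s - u v* Y))\<^sup>2 = 1 + (norm (u v* Y))\<^sup>2 - 2 * (s \<bullet> (u v* Y))"
        using s(1) by (simp add: power2_norm_eq_inner inner_simps norm_eq_1 inner_commute[of "u v* Y" s])
      then have "(norm (s - u v* Y))\<^sup>2 \<le> 2 * g"
        using n2 by (simp add: g_def)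
      then have b1: "norm (s - u v* Y) \<le> sqrt 2 * sqrt g"
        by (simp add: real_le_rsqrt flip: real_sqrt_mult)
      \<comment> \<open>With \<open>n = norm (u v* Y)\<close> this gives
        \<open>1 - n^2 \<le> 2 (1 - n) \<le> 2 g\<close>, which bounds the form of \<open>T\<close>
        at \<open>u\<close>.\<close>
      have "0 \<le> (1 - norm (u v* Y))\<^sup>2"
        by simp
      then have "1 - (norm (u v* Y))\<^sup>2 \<le> 2 * g"
        using sY by (simp add: g_def power2_eq_square algebra_simps)
      then have "\<delta> * (norm (a u))\<^sup>2 \<le> 2 * g"
        using ab(4)[of u] nu by (simp add: quad)
      then have "(norm (a u))\<^sup>2 \<le> 2 / \<delta> * g"
        using \<delta> by (simp add: field_simps)
      then have b2: "norm (a u) \<le> sqrt (2 / \<delta>) * sqrt g"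
        by (simp add: real_le_rsqrt flip: real_sqrt_mult)
      have "(norm (a u + b u))\<^sup>2 = (norm (a u))\<^sup>2 + (norm (b u))\<^sup>2"
        using ab(3) by (intro norm_add_Pythagorean) (simp add: orthogonal_def)
      then have "(norm u)\<^sup>2 = (norm (a u))\<^sup>2 + (norm (b u))\<^sup>2"
        by (simp flip: ab(1))
      then have "(norm (b u))\<^sup>2 \<le> 1\<^sup>2"
        unfolding nu power_one using zero_le_power2[of "norm (a u)"] by linarith
      then have nb: "norm (b u) \<le> 1"
        by (rule power2_le_imp_le) simp
      have bY: "b u v* Y = u v* Y - a u v* Y"
        using ab(1)[of u] linear_diff[OF linear_vector_matrix_mult[of Y], of u "a u"]
        by (metis add_diff_cancel_left')
      \<comment> \<open>One factor is exchanged at a time: \<open>s\<close> for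
        \<open>u v* Y\<close>, then \<open>u\<close> for \<open>b u\<close>, then
        \<open>u v* Y\<close> for \<open>b u v* Y\<close>.\<close>
      have "outer u s - outer (b u) (b u v* Y) =
          outer u (s - u v* Y) + outer (a u) (u v* Y) + outer (b u) (a u v* Y)"
      proof -
        have "a u = u - b u"
          using ab(1)[of u] by (metis add_diff_cancel_right')
        then show ?thesis
          unfolding bY by (simp only: outer_diff_right outer_diff_left) simp
      qed
      then have "norm (outer u s - outer (b u) (b u v* Y)) \<le>
          norm u * norm (s - u v* Y) + norm (a u) * norm (u v* Y) + norm (b u) * norm (a u v* Y)"
        by (metis norm_outer norm_triangle_mono norm_triangle_ineq order_refl)
      also have "\<dots> \<le> 1 * (sqrt 2 * sqrt g) + (sqrt (2 / \<delta>) * sqrt g) * 1 + 1 * (sqrt (2 / \<delta>) * sqrt g)"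
        using b1 b2 nb nY le[of "a u"] nu g \<delta>
        by (intro add_mono mult_mono) auto
      also have "\<dots> = K * sqrt g"
        by (simp add: K_def algebra_simps)
      finally have "norm (outer u s - outer (b u) (b u v* Y)) \<le> K * sqrt g" .
      then have "\<sigma> u * norm (outer u s - outer (b u) (b u v* Y)) \<le> \<sigma> u * (K * sqrt g)"
        using \<sigma> by (intro mult_left_mono) auto
      also have "\<dots> = K * (sqrt (\<sigma> u) * sqrt (h u))"
        using \<sigma> by (simp add: hg real_sqrt_mult mult_ac flip: mult.assoc[of "sqrt (\<sigma> u)" "sqrt (\<sigma> u)"])
      finally have "norm (\<sigma> u *\<^sub>R (outer u s - outer (b u) (b u v* Y))) \<le> K * (sqrt (\<sigma> u) * sqrt (h u))"
        using \<sigma> by simp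
      then show ?thesis
        using g \<sigma> by (simp add: hg s(2) outer_scaleR_right scaleR_diff_right)
    qed (simp_all add: h_def \<sigma>_def norm_outer)
    have "norm (X - X') = norm (\<Sum>u\<in>U. outer u (u v* X) - \<sigma> u *\<^sub>R outer (b u) (b u v* Y))"
      by (simp add: X'_def sum_subtractf sum_outer_orthonormal_basis[OF U(1)])
    also have "\<dots> \<le> (\<Sum>u\<in>U. K * (sqrt (\<sigma> u) * sqrt (h u)))"
      using h by (intro sum_norm_le) auto
    also have "\<dots> = K * (\<Sum>u\<in>U. sqrt (\<sigma> u) * sqrt (h u))"
      by (simp add: sum_distrib_left)
    finally have "(norm (X - X'))\<^sup>2 \<le> (K * (\<Sum>u\<in>U. sqrt (\<sigma> u) * sqrt (h u)))\<^sup>2"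
      by (rule power_mono) simp
    also have "\<dots> = K\<^sup>2 * (\<Sum>u\<in>U. sqrt (\<sigma> u) * sqrt (h u))\<^sup>2"
      by (rule power_mult_distrib)
    \<comment> \<open>Cauchy-Schwarz separates the singular values, which sum to the nuclear norm,
      from the shares \<open>h\<close>, which sum to the gap.\<close>
    also have "\<dots> \<le> K\<^sup>2 * ((\<Sum>u\<in>U. (sqrt (\<sigma> u))\<^sup>2) * (\<Sum>u\<in>U. (sqrt (h u))\<^sup>2))"
      by (intro mult_left_mono Cauchy_Schwarz_ineq_sum) simp
    also have "(\<Sum>u\<in>U. (sqrt (\<sigma> u))\<^sup>2) = nuclear_norm X"
      by (simp add: U(2) \<sigma>_def)
    also have "(\<Sum>u\<in>U. (sqrt (h u))\<^sup>2) = (\<Sum>u\<in>U. h u)"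
      using h by (intro sum.cong) auto
    also have "\<dots> = nuclear_norm X - X \<bullet> Y"
      by (simp add: h_def sum_subtractf U(2) \<sigma>_def inner_matrix_orthonormal_basis[OF U(1)])
    finally show ?thesis
      using X' by (auto simp: mult.assoc)
  qed
  then show thesis
    using that by blast
qed

section \<open>Tangent directions to the normal cone\<close>

lemma zero_in_contingent_cone:
  assumes "x \<in> K"
  shows "0 \<in> contingent_cone K x"
  unfolding contingent_cone_def mem_Collect_eq
  by (rule exI[of _ "\<lambda>k. inverse (real (Suc k))"], rule exI[of _ "\<lambda>k. 0"])
    (use assms LIMSEQ_inverse_real_of_nat in auto)

lemma contingent_cone_mono: "K \<subseteq> L \<Longrightarrow> contingent_cone K x \<subseteq> contingent_cone L x"
  unfolding contingent_cone_def by blast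

text \<open>Symmetry and the range condition are linear, so they pass to difference quotients and
  limits. Positivity is retained on the kernel of \<open>Y X^T\<close>, where the zero-order term of
  \<open>X + t V\<close> vanishes.\<close>

lemma tangent_normal_cone_conditions:
  assumes Y: "Y \<in> spectral_ball" and X: "X \<in> normal_cone spectral_ball Y"
    and W: "W \<in> contingent_cone (normal_cone spectral_ball Y) X"
  shows "(Y *v (a v* W)) \<bullet> b = a \<bullet> (Y *v (b v* W))"
    and "Y *v (a v* X) = 0 \<Longrightarrow> 0 \<le> a \<bullet> (Y *v (a v* W))"
    and "(Y *v (a v* W)) v* Y = a v* W"
proof -
  obtain t V where t: "\<And>k::nat. t k > 0" and V: "V \<longlonglongrightarrow> W"
    and XV: "\<And>k. X + t k *\<^sub>R V k \<in> normal_cone spectral_ball Y"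
    using W unfolding contingent_cone_def by blast
  note iff = mem_normal_cone_spectral_ball_iff_psd[OF Y]
  have expand: "Y *v (a v* (X + t k *\<^sub>R V k)) = Y *v (a v* X) + t k *\<^sub>R (Y *v (a v* V k))" for a k
    by (simp add: vector_matrix_mult_add vector_matrix_mult_scaleR matrix_vector_right_distrib
        matrix_vector_mult_scaleR)
  have limV: "(\<lambda>k. a v* V k) \<longlonglongrightarrow> a v* W" for a
    using V by (rule tendsto_vector_matrix_mult_left)
  have limYV: "(\<lambda>k. Y *v (a v* V k)) \<longlonglongrightarrow> Y *v (a v* W)" for a
    by (rule bounded_linear.tendsto[OF matrix_vector_mul_bounded_linear limV])
  have "(Y *v (a v* V k)) \<bullet> b = a \<bullet> (Y *v (b v* V k))" for k
  proof -
    have "(Y *v (a v* (X + t k *\<^sub>R V k))) \<bullet> b = a \<bullet> (Y *v (b v* (X + t k *\<^sub>R V k)))"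
      "(Y *v (a v* X)) \<bullet> b = a \<bullet> (Y *v (b v* X))"
      using XV[of k] X unfolding iff by blast+
    then show ?thesis
      using t[of k] unfolding expand by (simp add: inner_simps)
  qed
  moreover have "(\<lambda>k. (Y *v (a v* V k)) \<bullet> b) \<longlonglongrightarrow> (Y *v (a v* W)) \<bullet> b"
    by (intro tendsto_intros limYV)
  ultimately have "(\<lambda>k. a \<bullet> (Y *v (b v* V k))) \<longlonglongrightarrow> (Y *v (a v* W)) \<bullet> b"
    by simp
  moreover have "(\<lambda>k. a \<bullet> (Y *v (b v* V k))) \<longlonglongrightarrow> a \<bullet> (Y *v (b v* W))"
    by (intro tendsto_intros limYV)
  ultimately show "(Y *v (a v* W)) \<bullet> b = a \<bullet> (Y *v (b v* W))"
    by (rule LIMSEQ_unique)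
  have "(Y *v (a v* V k)) v* Y = a v* V k" for k
  proof -
    have "(Y *v (a v* (X + t k *\<^sub>R V k))) v* Y = a v* (X + t k *\<^sub>R V k)"
      "(Y *v (a v* X)) v* Y = a v* X"
      using XV[of k] X unfolding iff by blast+
    moreover have "(Y *v (a v* (X + t k *\<^sub>R V k))) v* Y =
        (Y *v (a v* X)) v* Y + t k *\<^sub>R ((Y *v (a v* V k)) v* Y)"
      unfolding expand
      by (simp only: linear_add[OF linear_vector_matrix_mult] linear_cmul[OF linear_vector_matrix_mult])
    ultimately have "t k *\<^sub>R ((Y *v (a v* V k)) v* Y) = t k *\<^sub>R (a v* V k)"
      by (auto simp: vector_matrix_mult_add vector_matrix_mult_scaleR)
    then show ?thesis
      using t[of k] by simp
  qed
  moreover have "(\<lambda>k. (Y *v (a v* V k)) v* Y) \<longlonglongrightarrow> (Y *v (a v* W)) v* Y"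
    using linear_vector_matrix_mult[of Y] limYV unfolding linear_conv_bounded_linear
    by (rule bounded_linear.tendsto)
  ultimately have "(\<lambda>k. a v* V k) \<longlonglongrightarrow> (Y *v (a v* W)) v* Y"
    by simp
  then show "(Y *v (a v* W)) v* Y = a v* W"
    using limV by (rule LIMSEQ_unique)
  assume z: "Y *v (a v* X) = 0"
  have "0 \<le> a \<bullet> (Y *v (a v* V k))" for k
  proof -
    have "0 \<le> a \<bullet> (Y *v (a v* (X + t k *\<^sub>R V k)))"
      using XV[of k] unfolding iff by blast
    then show ?thesis
      using t[of k] z unfolding expand by (simp add: zero_le_mult_iff)
  qed
  moreover have "(\<lambda>k. a \<bullet> (Y *v (a v* V k))) \<longlonglongrightarrow> a \<bullet> (Y *v (a v* W))"
    by (intro tendsto_intros limYV)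
  ultimately show "0 \<le> a \<bullet> (Y *v (a v* W))"
    by (intro LIMSEQ_le_const) auto
qed

text \<open>A perturbation \<open>A + t B\<close> of a positive semidefinite matrix \<open>A\<close> along a tangent direction \<open>B\<close> is
  made positive semidefinite by the correction \<open>t\<^sup>2 c B\<^sup>2\<close>: completing the square absorbs the mixed
  terms between the range and the kernel of \<open>A\<close>.\<close>

lemma psd_second_order_correction:
  fixes A B :: "'a::euclidean_space \<Rightarrow> 'a"
  assumes A: "linear A" "\<And>x y. A x \<bullet> y = x \<bullet> A y" "\<And>x. 0 \<le> x \<bullet> A x"
    and B: "linear B" "\<And>x y. B x \<bullet> y = x \<bullet> B y" "\<And>x. A x = 0 \<Longrightarrow> 0 \<le> x \<bullet> B x"
  obtains c \<tau> where "0 < \<tau>"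
    "\<And>t x. 0 < t \<Longrightarrow> t < \<tau> \<Longrightarrow> 0 \<le> x \<bullet> A x + t * (x \<bullet> B x) + t\<^sup>2 * (c * (B x \<bullet> B x))"
proof -
  obtain \<delta> where \<delta>: "\<delta> > 0"
    and gap: "\<And>x. \<exists>a b. x = a + b \<and> A b = 0 \<and> a \<bullet> b = 0 \<and> \<delta> * (norm a)\<^sup>2 \<le> x \<bullet> A x"
    using psd_spectral_gap[OF A] by metis
  obtain \<beta> where \<beta>: "\<beta> > 0" "\<And>x. norm (B x) \<le> \<beta> * norm x"
    using linear_bounded_pos[OF B(1)] by metis
  \<comment> \<open>For such \<open>t\<close>, the term \<open>t * (p \<bullet> B p)\<close> uses at
    most half of \<open>\<delta> * (norm p)^2\<close>. The other half completes the square, which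
    fixes the constant \<open>2 / \<delta>\<close>.\<close>
  have "0 \<le> x \<bullet> A x + t * (x \<bullet> B x) + t\<^sup>2 * (2 / \<delta> * (B x \<bullet> B x))"
    if t: "0 < t" "t < \<delta> / (2 * \<beta>)" for t x
  proof -
    obtain p q where x: "x = p + q" and q: "A q = 0" and p: "\<delta> * (norm p)\<^sup>2 \<le> x \<bullet> A x"
      using gap by metis
    define P N where "P = norm p" and "N = norm (B x)"
    \<comment> \<open>The mixed terms are written through \<open>B x\<close> instead of
      \<open>B q\<close>, so that the correction \<open>B x \<bullet> B x\<close> can absorb
      them.\<close>
    have "x \<bullet> B x = 2 * (p \<bullet> B x) - p \<bullet> B p + q \<bullet> B q"
      using B(2)[of p q] by (simp add: x linear_add[OF B(1)] inner_simps inner_commute[of q "B p"])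
    moreover have "- (P * N) \<le> p \<bullet> B x"
      using Cauchy_Schwarz_ineq2[of p "B x"] by (simp add: P_def N_def)
    moreover have "p \<bullet> B p \<le> \<beta> * P\<^sup>2"
    proof -
      have "p \<bullet> B p \<le> norm p * norm (B p)"
        by (rule norm_cauchy_schwarz)
      also have "\<dots> \<le> norm p * (\<beta> * norm p)"
        by (intro mult_left_mono \<beta>) simp
      finally show ?thesis
        by (simp add: P_def power2_eq_square mult_ac)
    qed
    ultimately have "- (2 * (P * N)) - \<beta> * P\<^sup>2 \<le> x \<bullet> B x"
      using B(3)[OF q] by linarith
    then have "t * (- (2 * (P * N)) - \<beta> * P\<^sup>2) \<le> t * (x \<bullet> B x)"
      using t(1) by (intro mult_left_mono) auto
    moreover have "t * \<beta> * P\<^sup>2 \<le> \<delta> / 2 * P\<^sup>2"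
      using t \<beta>(1) by (intro mult_right_mono) (auto simp: field_simps)
    moreover have "\<delta> / 2 * (P - 2 / \<delta> * t * N)\<^sup>2 = \<delta> / 2 * P\<^sup>2 - 2 * t * (P * N) + t\<^sup>2 * (2 / \<delta> * N\<^sup>2)"
      using \<delta> by (simp add: power2_eq_square field_simps)
    then have "0 \<le> \<delta> / 2 * P\<^sup>2 - 2 * t * (P * N) + t\<^sup>2 * (2 / \<delta> * N\<^sup>2)"
      using \<delta> by (metis zero_le_mult_iff zero_le_power2 half_gt_zero less_imp_le)
    moreover have "B x \<bullet> B x = N\<^sup>2"
      by (simp add: N_def power2_norm_eq_inner)
    ultimately show ?thesis
      using p[folded P_def] by (simp add: algebra_simps)
  qed
  then show thesis
    using that[of "\<delta> / (2 * \<beta>)" "2 / \<delta>"] \<delta> \<beta>(1) by simp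
qed

text \<open>Upgrades a direction given by sequences to an arc in the cone: for
  \<open>A = Y X^T\<close> and \<open>B = Y W^T\<close>, the tangent conditions are the hypotheses
  of the second-order correction.\<close>

lemma contingent_normal_cone_second_order:
  assumes Y: "Y \<in> spectral_ball" and X: "X \<in> normal_cone spectral_ball Y"
    and W: "W \<in> contingent_cone (normal_cone spectral_ball Y) X"
  obtains C \<tau> where "0 < \<tau>"
    "\<And>t. 0 < t \<Longrightarrow> t < \<tau> \<Longrightarrow> X + t *\<^sub>R W + t\<^sup>2 *\<^sub>R C \<in> normal_cone spectral_ball Y"
proof -
  define A where "A = (\<lambda>a. Y *v (a v* X))"
  define B where "B = (\<lambda>a. Y *v (a v* W))"
  note iff = mem_normal_cone_spectral_ball_iff_psd[OF Y]
  note tangent = tangent_normal_cone_conditions[OF Y X W]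
  have linA: "linear A" and linB: "linear B"
    unfolding A_def B_def by (rule linear_gram)+
  have symA: "A x \<bullet> y = x \<bullet> A y" and psdA: "0 \<le> x \<bullet> A x" and rangeA: "A x v* Y = x v* X" for x y
    using X unfolding iff A_def by blast+
  have symB: "B x \<bullet> y = x \<bullet> B y" and rangeB: "B x v* Y = x v* W" for x y
    using tangent unfolding B_def by blast+
  have kerA: "0 \<le> x \<bullet> B x" if "A x = 0" for x
    using tangent(2) that unfolding A_def B_def by blast
  obtain c \<tau> where \<tau>: "0 < \<tau>"
    and pos: "\<And>t x. 0 < t \<Longrightarrow> t < \<tau> \<Longrightarrow> 0 \<le> x \<bullet> A x + t * (x \<bullet> B x) + t\<^sup>2 * (c * (B x \<bullet> B x))"
    by (rule psd_second_order_correction[OF linA symA psdA linB symB kerA]) blast+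
  \<comment> \<open>Chosen so that \<open>Y C^T = c B^2\<close>, which restores positivity; symmetry
    and the range condition for \<open>C\<close> follow from those for \<open>W\<close>.\<close>
  define C where "C = c *\<^sub>R (W ** transpose Y ** W)"
  have aC: "a v* C = c *\<^sub>R (B a v* W)" for a
    by (simp add: C_def B_def vector_matrix_mult_scaleR flip: vector_matrix_mul_assoc)
  have "X + t *\<^sub>R W + t\<^sup>2 *\<^sub>R C \<in> normal_cone spectral_ball Y" if t: "0 < t" "t < \<tau>" for t
  proof -
    let ?X = "X + t *\<^sub>R W + t\<^sup>2 *\<^sub>R C"
    have aX: "a v* ?X = a v* X + t *\<^sub>R (a v* W) + t\<^sup>2 *\<^sub>R c *\<^sub>R (B a v* W)" for a
      by (simp add: vector_matrix_mult_add vector_matrix_mult_scaleR aC)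
    have YX: "Y *v (a v* ?X) = A a + t *\<^sub>R B a + t\<^sup>2 *\<^sub>R c *\<^sub>R B (B a)" for a
      unfolding aX by (simp add: A_def B_def matrix_vector_right_distrib matrix_vector_mult_scaleR)
    show ?thesis
      unfolding iff YX
    proof (intro conjI allI)
      fix a b
      show "(A a + t *\<^sub>R B a + t\<^sup>2 *\<^sub>R c *\<^sub>R B (B a)) \<bullet> b = a \<bullet> (A b + t *\<^sub>R B b + t\<^sup>2 *\<^sub>R c *\<^sub>R B (B b))"
        by (simp add: inner_simps symA symB)
      show "0 \<le> a \<bullet> (A a + t *\<^sub>R B a + t\<^sup>2 *\<^sub>R c *\<^sub>R B (B a))"
        using pos[OF t, of a] symB[of a "B a"] by (simp add: inner_simps)
      show "(A a + t *\<^sub>R B a + t\<^sup>2 *\<^sub>R c *\<^sub>R B (B a)) v* Y = a v* ?X"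
        unfolding aX
        by (simp add: linear_add[OF linear_vector_matrix_mult] linear_cmul[OF linear_vector_matrix_mult]
            rangeA rangeB)
    qed
  qed
  then show thesis
    using that \<tau> by blast
qed

section \<open>Dual certificates\<close>

lemma subspace_inner_bounded_below_eq_0:
  fixes a :: "'a::real_inner"
  assumes "subspace S" "\<And>x. x \<in> S \<Longrightarrow> b < a \<bullet> x" "x \<in> S"
  shows "a \<bullet> x = 0"
proof (rule ccontr)
  assume "a \<bullet> x \<noteq> 0"
  \<comment> \<open>The multiple of \<open>x\<close> at which the functional takes the excluded
    value \<open>b\<close> itself.\<close>
  moreover have "b < a \<bullet> ((b / (a \<bullet> x)) *\<^sub>R x)"
    using assms by (blast intro: subspace_scale)
  ultimately show False
    by simp
qed

lemma orthogonal_range_adjoint_imp_ker: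
  fixes f :: "'a::euclidean_space \<Rightarrow> 'b::euclidean_space"
  assumes "linear f" "\<And>D. D \<in> range (adjoint f) \<Longrightarrow> a \<bullet> D = 0"
  shows "f a = 0"
proof -
  have "f a \<bullet> f a = a \<bullet> adjoint f (f a)"
    using adjoint_works[OF assms(1)] by simp
  then show ?thesis
    using assms(2) by simp
qed

lemma inner_range_adjoint_cong:
  fixes f :: "'a::euclidean_space \<Rightarrow> 'b::euclidean_space"
  assumes "linear f" "Y \<in> range (adjoint f)" "f x = f x'"
  shows "x \<bullet> Y = x' \<bullet> Y"
  using assms(2,3) adjoint_works[OF assms(1)] by auto

lemma subspace_range_adjoint:
  fixes f :: "'a::euclidean_space \<Rightarrow> 'b::euclidean_space"
  assumes "linear f"
  shows "subspace (range (adjoint f))"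
  using linear_subspace_image[OF adjoint_linear[OF assms] subspace_UNIV] by simp

text \<open>The ball is compact and maximality of \<open>Y k\<close> passes to the limit. Along
  curves this takes the place of directional derivatives of the nuclear norm.\<close>

lemma subgradient_limit:
  fixes X :: "nat \<Rightarrow> real^'n^'m"
  assumes "X \<longlonglongrightarrow> X0"
  obtains Y r Y0 where "\<And>k. Y k \<in> spectral_ball" "\<And>k. X k \<bullet> Y k = nuclear_norm (X k)"
    "strict_mono (r :: nat \<Rightarrow> nat)" "(\<lambda>k. Y (r k)) \<longlonglongrightarrow> Y0" "Y0 \<in> subdifferential nuclear_norm X0"
proof -
  have "\<exists>Z. Z \<in> spectral_ball \<and> X k \<bullet> Z = nuclear_norm (X k)" for k
    using nuclear_norm_attained by metis
  then obtain Y where Y: "\<And>k. Y k \<in> spectral_ball" "\<And>k. X k \<bullet> Y k = nuclear_norm (X k)"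
    by metis
  then obtain Y0 r where Y0: "Y0 \<in> spectral_ball" and r: "strict_mono (r :: nat \<Rightarrow> nat)"
    and lim: "(Y \<circ> r) \<longlonglongrightarrow> Y0"
    using compact_spectral_ball unfolding compact_def by metis
  have lim': "(\<lambda>k. Y (r k)) \<longlonglongrightarrow> Y0"
    using lim by (simp add: o_def)
  obtain Z where Z: "Z \<in> spectral_ball" "X0 \<bullet> Z = nuclear_norm X0"
    using nuclear_norm_attained by metis
  have "(\<lambda>k. X (r k)) \<longlonglongrightarrow> X0"
    using LIMSEQ_subseq_LIMSEQ[OF assms r] by (simp add: o_def)
  then have "(\<lambda>k. X (r k) \<bullet> Z) \<longlonglongrightarrow> X0 \<bullet> Z" "(\<lambda>k. X (r k) \<bullet> Y (r k)) \<longlonglongrightarrow> X0 \<bullet> Y0"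
    using lim' by (auto intro!: tendsto_intros)
  moreover have "X (r k) \<bullet> Z \<le> X (r k) \<bullet> Y (r k)" for k
    using inner_le_nuclear_norm[OF Z(1)] Y(2) by simp
  ultimately have "X0 \<bullet> Z \<le> X0 \<bullet> Y0"
    by (intro LIMSEQ_le) auto
  then have "Y0 \<in> subdifferential nuclear_norm X0"
    using Y0 Z(2) inner_le_nuclear_norm[OF Y0, of X0] by (simp add: subdifferential_nuclear_norm)
  then show thesis
    using that Y r lim' by blast
qed

lemma dual_certificate_iff:
  "Y \<in> dual_certificate_set \<Phi> X0 \<longleftrightarrow>
    Y \<in> range (adjoint \<Phi>) \<and> Y \<in> spectral_ball \<and> X0 \<bullet> Y = nuclear_norm X0"
  by (simp add: dual_certificate_set_def subdifferential_nuclear_norm)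

lemma dual_certificate_normal_cone:
  "Y \<in> dual_certificate_set \<Phi> X0 \<Longrightarrow> X0 \<in> normal_cone spectral_ball Y"
  by (simp add: dual_certificate_iff mem_normal_cone_spectral_ball_iff)

lemma min_unit_singular_values_attained:
  assumes "dual_certificate_set \<Phi> X0 \<noteq> {}"
  obtains Y where "Y \<in> dual_certificate_set \<Phi> X0"
    "num_unit_singular_values Y = min_unit_singular_values \<Phi> X0"
proof -
  have "min_unit_singular_values \<Phi> X0 \<in> num_unit_singular_values ` dual_certificate_set \<Phi> X0"
    unfolding min_unit_singular_values_def using assms by (intro Inf_nat_def1) auto
  then show thesis
    using that by auto
qed

context
  fixes \<Phi> :: "real^'n2^'n1 \<Rightarrow> real^'m"
  assumes lin: "linear \<Phi>"
begin

text \<open>Weak duality: \<open>Y\<close> has the same inner product with \<open>X\<close> as with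
  \<open>X0\<close>, whose nuclear norm it attains.\<close>

lemma dual_certificate_le:
  assumes "Y \<in> dual_certificate_set \<Phi> X0" "\<Phi> X = \<Phi> X0"
  shows "nuclear_norm X0 \<le> nuclear_norm X"
  using assms inner_range_adjoint_cong[OF lin, of Y X X0] inner_le_nuclear_norm[of Y X]
  by (simp add: dual_certificate_iff)

text \<open>If the compact subdifferential misses the range of the adjoint, a separating normal
  \<open>a\<close> lies in the kernel of \<open>\<Phi>\<close>, and its inner products with all
  subgradients stay below a negative number: a feasible descent direction.\<close>

lemma dual_certificate_exists:
  assumes opt: "optimal_solution \<Phi> M\<^sub>0 X0"
  shows "dual_certificate_set \<Phi> X0 \<noteq> {}"
proof
  assume empty: "dual_certificate_set \<Phi> X0 = {}"
  let ?S = "subdifferential nuclear_norm X0" and ?T = "range (adjoint \<Phi>)"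
  have "?S \<noteq> {}"
    using nuclear_norm_attained[of X0] unfolding subdifferential_nuclear_norm by blast
  moreover have "?S \<inter> ?T = {}"
    using empty by (auto simp: dual_certificate_set_def)
  ultimately obtain a b where ab: "\<And>x. x \<in> ?S \<Longrightarrow> a \<bullet> x < b" "\<And>x. x \<in> ?T \<Longrightarrow> b < a \<bullet> x"
    using separating_hyperplane_compact_closed[of ?S ?T] convex_subdifferential_nuclear_norm
      compact_subdifferential_nuclear_norm subspace_imp_convex[OF subspace_range_adjoint[OF lin]]
      closed_subspace[OF subspace_range_adjoint[OF lin]] by metis
  have a0: "a \<bullet> x = 0" if "x \<in> ?T" for x
    using subspace_inner_bounded_below_eq_0[OF subspace_range_adjoint[OF lin] ab(2) that] .
  then have "\<Phi> a = 0"
    by (rule orthogonal_range_adjoint_imp_ker[OF lin])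
  have "b < 0"
    using ab(2)[of 0] subspace_0[OF subspace_range_adjoint[OF lin]] by simp
  define t where "t k = inverse (real (Suc k))" for k
  have t: "t k > 0" for k
    by (simp add: t_def)
  have "t \<longlonglongrightarrow> 0"
    unfolding t_def by (rule LIMSEQ_inverse_real_of_nat)
  then have "(\<lambda>k. X0 + t k *\<^sub>R a) \<longlonglongrightarrow> X0 + 0 *\<^sub>R a"
    by (intro tendsto_intros)
  then have "(\<lambda>k. X0 + t k *\<^sub>R a) \<longlonglongrightarrow> X0"
    by simp
  then obtain Y r Y0 where Y: "\<And>k. Y k \<in> spectral_ball"
    "\<And>k. (X0 + t k *\<^sub>R a) \<bullet> Y k = nuclear_norm (X0 + t k *\<^sub>R a)"
    and lim: "(\<lambda>k. Y (r k)) \<longlonglongrightarrow> Y0" and Y0: "Y0 \<in> ?S"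
    by (rule subgradient_limit) blast
  \<comment> \<open>The increment of the nuclear norm along \<open>a\<close> is nonnegative by
    optimality and at most \<open>t k * (a \<bullet> Y k)\<close> by the subgradient at the new
    point.\<close>
  have "0 \<le> a \<bullet> Y k" for k
  proof -
    have "\<Phi> (X0 + t k *\<^sub>R a) = M\<^sub>0"
      using opt \<open>\<Phi> a = 0\<close> by (simp add: optimal_solution_def linear_add[OF lin] linear_cmul[OF lin])
    then have "nuclear_norm X0 \<le> nuclear_norm (X0 + t k *\<^sub>R a)"
      using opt by (simp add: optimal_solution_def)
    also have "\<dots> = X0 \<bullet> Y k + t k * (a \<bullet> Y k)"
      by (simp add: inner_simps flip: Y(2))
    also have "X0 \<bullet> Y k \<le> nuclear_norm X0"
      using Y(1) by (rule inner_le_nuclear_norm)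
    finally show ?thesis
      using t[of k] by (simp add: zero_le_mult_iff)
  qed
  moreover have "(\<lambda>k. a \<bullet> Y (r k)) \<longlonglongrightarrow> a \<bullet> Y0"
    using lim by (intro tendsto_intros)
  ultimately have "0 \<le> a \<bullet> Y0"
    by (intro LIMSEQ_le_const) auto
  then show False
    using ab(1)[OF Y0] \<open>b < 0\<close> by simp
qed

lemma convex_dual_certificate_set: "convex (dual_certificate_set \<Phi> X0)"
  unfolding dual_certificate_set_def
  by (intro convex_Int convex_subdifferential_nuclear_norm
      subspace_imp_convex subspace_range_adjoint lin)

lemma dual_certificate_normal_cone_minimal:
  assumes Y: "Y \<in> dual_certificate_set \<Phi> X0" and Y': "Y' \<in> dual_certificate_set \<Phi> X0"
    and min: "num_unit_singular_values Y = min_unit_singular_values \<Phi> X0"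
  shows "normal_cone spectral_ball Y \<subseteq> normal_cone spectral_ball Y'"
proof (rule normal_cone_minimal_unit_singular_values[OF convex_dual_certificate_set _ Y Y'])
  show "dual_certificate_set \<Phi> X0 \<subseteq> spectral_ball"
    by (auto simp: dual_certificate_iff)
  show "num_unit_singular_values Y \<le> num_unit_singular_values Z"
    if "Z \<in> dual_certificate_set \<Phi> X0" for Z
    using that unfolding min min_unit_singular_values_def by (intro cINF_lower) auto
qed

section \<open>Strong solutions\<close>

lemma strong_solution_if_certificate:
  assumes feas: "\<Phi> X0 = M\<^sub>0" and Y: "Y \<in> dual_certificate_set \<Phi> X0"
    and trivial: "ker \<Phi> \<inter> contingent_cone (normal_cone spectral_ball Y) X0 = {0}"
  shows "strong_solution \<Phi> M\<^sub>0 X0"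
proof (rule ccontr)
  assume not: "\<not> strong_solution \<Phi> M\<^sub>0 X0"
  define e where "e k = inverse (real (Suc k))" for k
  have e: "e k > 0" "e k \<le> 1" for k
    by (simp_all add: e_def inverse_le_1_iff)
  have e0: "e \<longlonglongrightarrow> 0"
    unfolding e_def by (rule LIMSEQ_inverse_real_of_nat)
  have "\<exists>X. \<Phi> X = M\<^sub>0 \<and> norm (X - X0) \<le> e k \<and>
      nuclear_norm X - nuclear_norm X0 < e k * (norm (X - X0))\<^sup>2" for k
    using not feas e(1)[of k] unfolding strong_solution_def by (meson not_le)
  then obtain X where X: "\<And>k. \<Phi> (X k) = M\<^sub>0" "\<And>k. norm (X k - X0) \<le> e k"
    "\<And>k. nuclear_norm (X k) - nuclear_norm X0 < e k * (norm (X k - X0))\<^sup>2"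
    by metis
  define t where "t k = norm (X k - X0)" for k
  have t: "t k > 0" for k
  proof -
    have "X k \<noteq> X0"
      using X(3)[of k] by auto
    then show ?thesis
      by (simp add: t_def)
  qed
  have t0: "t \<longlonglongrightarrow> 0"
    using e0 X(2) t by (intro tendsto_sandwich[OF _ _ tendsto_const e0])
      (auto simp: t_def intro!: always_eventually)
  define W where "W k = (X k - X0) /\<^sub>R t k" for k
  have "W k \<in> sphere 0 1" for k
    using t[of k] by (simp add: W_def) (simp add: t_def)
  then obtain W0 r where W0: "W0 \<in> sphere 0 1" and r: "strict_mono (r :: nat \<Rightarrow> nat)"
    and limW: "(W \<circ> r) \<longlonglongrightarrow> W0"
    using compact_sphere[of "0 :: real^'n2^'n1" 1] unfolding compact_def by metis
  have "\<Phi> (W k) = 0" for k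
    using X(1) feas by (simp add: W_def linear_diff[OF lin] linear_cmul[OF lin])
  moreover have "(\<lambda>k. \<Phi> ((W \<circ> r) k)) \<longlonglongrightarrow> \<Phi> W0"
    using lin limW unfolding linear_conv_bounded_linear by (rule bounded_linear.tendsto)
  ultimately have "\<Phi> W0 = 0"
    by (simp add: LIMSEQ_const_iff)
  have Yb: "Y \<in> spectral_ball" and Y0: "X0 \<bullet> Y = nuclear_norm X0"
    using Y by (auto simp: dual_certificate_iff)
  \<comment> \<open>Hence the gap \<open>nuclear_norm (X k) - X k \<bullet> Y\<close> is the excess
    of the objective, which is below \<open>e k * (t k)^2\<close>.\<close>
  have XY: "X k \<bullet> Y = nuclear_norm X0" for k
    using inner_range_adjoint_cong[OF lin, of Y "X k" X0] Y X(1) feas by (simp add: dual_certificate_iff)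
  obtain C where C: "\<And>X. \<exists>X'\<in>normal_cone spectral_ball Y.
      (norm (X - X'))\<^sup>2 \<le> C * nuclear_norm X * (nuclear_norm X - X \<bullet> Y)"
    using nuclear_norm_quadratic_growth[OF Yb] by blast
  then obtain P where P: "\<And>X. P X \<in> normal_cone spectral_ball Y"
    "\<And>X. (norm (X - P X))\<^sup>2 \<le> C * nuclear_norm X * (nuclear_norm X - X \<bullet> Y)"
    by metis
  \<comment> \<open>Difference quotients of approximants inside the normal cone. The gap estimate
    brings them within \<open>sqrt (K * e k)\<close> of \<open>W k\<close>, so they share its
    limit.\<close>
  define V where "V k = (P (X k) - X0) /\<^sub>R t k" for k
  \<comment> \<open>Bounds \<open>C * nuclear_norm (X k)\<close>: the excess is at most one, and the
    sign of \<open>C\<close> is not known.\<close>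
  define K where "K = \<bar>C\<bar> * (nuclear_norm X0 + 1)"
  have "(norm (W k - V k))\<^sup>2 \<le> K * e k" for k
  proof -
    have "W k - V k = (X k - P (X k)) /\<^sub>R t k"
      by (simp add: W_def V_def algebra_simps)
    then have "(norm (W k - V k))\<^sup>2 = (norm (X k - P (X k)))\<^sup>2 / (t k)\<^sup>2"
      using t[of k] by (simp add: power_mult_distrib divide_inverse power_inverse mult.commute)
    also have "\<dots> \<le> K * e k * (t k)\<^sup>2 / (t k)\<^sup>2"
    proof (rule divide_right_mono)
      let ?g = "nuclear_norm (X k) - nuclear_norm X0"
      have g: "0 \<le> ?g" "?g \<le> e k * (t k)\<^sup>2"
        using dual_certificate_le[OF Y, of "X k"] X(1) feas X(3)[of k] by (auto simp: t_def)
      have "(t k)\<^sup>2 \<le> 1"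
        using X(2)[of k] e(2)[of k] t[of k] by (intro power_le_one) (auto simp: t_def)
      then have "e k * (t k)\<^sup>2 \<le> 1"
        using e[of k] by (intro mult_le_one) auto
      then have "nuclear_norm (X k) \<le> nuclear_norm X0 + 1"
        using g by simp
      then have "\<bar>C\<bar> * nuclear_norm (X k) * ?g \<le> K * (e k * (t k)\<^sup>2)"
        unfolding K_def using g nuclear_norm_nonneg[of "X k"] nuclear_norm_nonneg[of X0]
        by (intro mult_mono mult_nonneg_nonneg mult_left_mono) auto
      moreover have "C * nuclear_norm (X k) * ?g \<le> \<bar>C\<bar> * nuclear_norm (X k) * ?g"
        using g nuclear_norm_nonneg[of "X k"] by (intro mult_right_mono) auto
      ultimately show "(norm (X k - P (X k)))\<^sup>2 \<le> K * e k * (t k)\<^sup>2"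
        using P(2)[of "X k"] by (simp add: XY mult.assoc)
    qed simp
    also have "\<dots> = K * e k"
      using t[of k] by simp
    finally show ?thesis .
  qed
  then have "norm (W k - V k) \<le> sqrt (K * e k)" for k
    by (rule real_le_rsqrt)
  moreover have "(\<lambda>k. sqrt (K * e k)) \<longlonglongrightarrow> sqrt (K * 0)"
    by (intro tendsto_intros e0)
  ultimately have "(\<lambda>k. W k - V k) \<longlonglongrightarrow> 0"
    using Lim_null_comparison[of "\<lambda>k. W k - V k" "\<lambda>k. sqrt (K * e k)" sequentially] by simp
  from tendsto_diff[OF limW LIMSEQ_subseq_LIMSEQ[OF this r]]
  have "(\<lambda>k. V (r k)) \<longlonglongrightarrow> W0"
    by (simp add: o_def)
  moreover have "(\<lambda>k. t (r k)) \<longlonglongrightarrow> 0"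
    using LIMSEQ_subseq_LIMSEQ[OF t0 r] by (simp add: o_def)
  moreover have "X0 + t (r k) *\<^sub>R V (r k) \<in> normal_cone spectral_ball Y" for k
    using P(1)[of "X (r k)"] t[of "r k"] by (simp add: V_def)
  ultimately have "W0 \<in> contingent_cone (normal_cone spectral_ball Y) X0"
    unfolding contingent_cone_def mem_Collect_eq
    by (intro exI[of _ "\<lambda>k. t (r k)"] exI[of _ "\<lambda>k. V (r k)"]) (auto simp: t)
  then have "W0 = 0"
    using trivial \<open>\<Phi> W0 = 0\<close> by (auto simp: ker_def)
  then show False
    using W0 by simp
qed

end

section \<open>From quadratic growth to trivial tangent directions\<close>

text \<open>A minimax exchange. For a single \<open>D\<close>, a \<open>Z\<close> orthogonal to
  \<open>S\<close> makes the product arbitrarily negative unless \<open>D - Y\<close> lies in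
  \<open>S\<close>, where \<open>orth\<close> gives zero. Separation yields one \<open>Z\<close> for
  the whole compact \<open>G\<close>, at the price \<open>\<eta>\<close>.\<close>

lemma minimax_separation:
  fixes C Y :: "'a::euclidean_space"
  assumes G: "convex G" "compact G" "Y \<in> G" and S: "subspace S"
    and orth: "\<And>D. D \<in> G \<Longrightarrow> D - Y \<in> S \<Longrightarrow> C \<bullet> (D - Y) = 0"
    and \<eta>: "0 < \<eta>"
  obtains Z where "\<And>D. D \<in> S \<Longrightarrow> Z \<bullet> D = 0" "\<And>D. D \<in> G \<Longrightarrow> (Z - C) \<bullet> (D - Y) < \<eta>"
proof -
  \<comment> \<open>The second coordinate records the cost. By \<open>orth\<close>, points of
    \<open>A\<close> over \<open>S\<close> have cost zero and so miss \<open>B\<close>, where the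
    cost is at least \<open>\<eta>\<close>.\<close>
  define L where "L D = (D, - (C \<bullet> D))" for D
  define A where "A = L ` ((\<lambda>D. D - Y) ` G)"
  define B where "B = S \<times> {\<eta>..}"
  have "linear L"
    unfolding L_def by (intro linearI) (auto simp: inner_simps)
  then have "convex A"
    unfolding A_def by (intro convex_linear_image convex_translation_subtract G)
  moreover have "compact A"
    unfolding A_def L_def by (intro compact_continuous_image continuous_intros G)
  moreover have "A \<noteq> {}"
    using G(3) by (auto simp: A_def)
  moreover have "convex B" "closed B"
    unfolding B_def using subspace_imp_convex[OF S] closed_subspace[OF S]
    by (auto intro!: convex_Times closed_Times)
  moreover have "A \<inter> B = {}"
    using orth \<eta> by (auto simp: A_def B_def L_def)
  ultimately obtain p b where A: "\<And>x. x \<in> A \<Longrightarrow> p \<bullet> x < b" and B: "\<And>x. x \<in> B \<Longrightarrow> b < p \<bullet> x"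
    using separating_hyperplane_compact_closed[of A B] by metis
  obtain Z \<theta> where p: "p = (Z, \<theta>)"
    by (cases p)
  have B': "b < Z \<bullet> D + \<theta> * \<eta>" if "D \<in> S" for D
    using B[of "(D, \<eta>)"] that by (simp add: p B_def)
  then have Z: "Z \<bullet> D = 0" if "D \<in> S" for D
    using subspace_inner_bounded_below_eq_0[OF S _ that, of "b - \<theta> * \<eta>" Z] by (simp add: less_diff_eq diff_less_eq)
  have A': "Z \<bullet> (D - Y) - \<theta> * (C \<bullet> (D - Y)) < b" if "D \<in> G" for D
    using A[of "L (D - Y)"] that by (simp add: p A_def L_def)
  \<comment> \<open>\<open>D = Y\<close> maps to the origin, which gives \<open>0 < b\<close>; then
    \<open>\<theta>\<close> is positive and the normal can be rescaled by it.\<close>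
  have b: "0 < b" "b < \<theta> * \<eta>"
    using A'[OF G(3)] B'[of 0] subspace_0[OF S] by simp_all
  then have \<theta>: "0 < \<theta>"
    using \<eta> by (metis less_trans zero_less_mult_pos2)
  have "(Z /\<^sub>R \<theta> - C) \<bullet> (D - Y) < \<eta>" if "D \<in> G" for D
  proof -
    have "\<theta> * ((Z /\<^sub>R \<theta> - C) \<bullet> (D - Y)) = Z \<bullet> (D - Y) - \<theta> * (C \<bullet> (D - Y))"
      using \<theta> by (simp add: inner_diff_left right_diff_distrib)
    also have "\<dots> < \<theta> * \<eta>"
      using A'[OF that] b by simp
    finally show ?thesis
      using \<theta> by simp
  qed
  then show thesis
    using that[of "Z /\<^sub>R \<theta>"] Z by simp
qed

text \<open>If a nonzero \<open>W\<close> lay in the kernel and in the tangent cone, \<open>X0 + t W + t\<^sup>2 C\<close> would stay in the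
  normal cone for some \<open>C\<close>. The separation lemma replaces \<open>C\<close> by a feasible direction \<open>Z\<close> at an
  arbitrarily small second-order cost, contradicting quadratic growth along \<open>X0 + t W + t\<^sup>2 Z\<close>.\<close>

lemma strong_solution_imp_tangent_trivial:
  fixes \<Phi> :: "real^'n2^'n1 \<Rightarrow> real^'m"
  assumes lin: "linear \<Phi>" and strong: "strong_solution \<Phi> M\<^sub>0 X0"
    and Y: "Y \<in> dual_certificate_set \<Phi> X0"
    and min: "\<And>Y'. Y' \<in> dual_certificate_set \<Phi> X0 \<Longrightarrow> normal_cone spectral_ball Y \<subseteq> normal_cone spectral_ball Y'"
    and \<Phi>W: "\<Phi> W = 0" and W: "W \<in> contingent_cone (normal_cone spectral_ball Y) X0"
  shows "W = 0"
proof (rule ccontr)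
  assume "W \<noteq> 0"
  obtain c \<epsilon> where c: "c > 0" and \<epsilon>: "\<epsilon> > 0"
    and growth: "\<And>X. \<Phi> X = \<Phi> X0 \<Longrightarrow> norm (X - X0) \<le> \<epsilon> \<Longrightarrow>
      c * (norm (X - X0))\<^sup>2 \<le> nuclear_norm X - nuclear_norm X0"
    using strong unfolding strong_solution_def by metis
  have Yr: "Y \<in> range (adjoint \<Phi>)" and Yb: "Y \<in> spectral_ball" and XY: "X0 \<bullet> Y = nuclear_norm X0"
    using Y by (auto simp: dual_certificate_iff)
  have kerY: "Z \<bullet> D = 0" if "\<Phi> Z = 0" "D \<in> range (adjoint \<Phi>)" for Z D
    using inner_range_adjoint_cong[OF lin that(2), of Z 0] that(1) by (simp add: linear_0[OF lin])
  obtain C \<tau> where \<tau>: "0 < \<tau>"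
    and arc: "\<And>t. 0 < t \<Longrightarrow> t < \<tau> \<Longrightarrow> X0 + t *\<^sub>R W + t\<^sup>2 *\<^sub>R C \<in> normal_cone spectral_ball Y"
    using contingent_normal_cone_second_order[OF Yb dual_certificate_normal_cone[OF Y] W] by metis
  \<comment> \<open>The limit \<open>D0\<close> of subgradients along the curve below lies
    here.\<close>
  define G where "G = {D \<in> subdifferential nuclear_norm X0. 0 \<le> W \<bullet> D}"
  have halfspace: "G = subdifferential nuclear_norm X0 \<inter> {D. 0 \<le> W \<bullet> D}"
    by (auto simp: G_def)
  have G: "convex G" "compact G"
    unfolding halfspace
    by (intro convex_Int convex_subdifferential_nuclear_norm convex_halfspace_ge,
        intro compact_Int_closed compact_subdifferential_nuclear_norm closed_halfspace_ge)
  have YG: "Y \<in> G"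
    using Y kerY[OF \<Phi>W Yr] by (simp add: G_def dual_certificate_set_def)
  have orth: "C \<bullet> (D - Y) = 0" if D: "D \<in> G" "D - Y \<in> range (adjoint \<Phi>)" for D
  proof -
    have "D \<in> range (adjoint \<Phi>)"
      using subspace_add[OF subspace_range_adjoint[OF lin] D(2) Yr] by simp
    then have cert: "D \<in> dual_certificate_set \<Phi> X0"
      using D(1) by (simp add: G_def dual_certificate_set_def)
    \<comment> \<open>One point of the arc suffices: \<open>Y\<close> and \<open>D\<close> both
      attain its nuclear norm, and once the \<open>X0\<close> and \<open>W\<close> terms cancel only
      \<open>C\<close> remains.\<close>
    let ?X = "X0 + (\<tau>/2) *\<^sub>R W + (\<tau>/2)\<^sup>2 *\<^sub>R C"
    have "?X \<in> normal_cone spectral_ball Y"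
      using \<tau> by (intro arc) auto
    then have "?X \<in> normal_cone spectral_ball Y" "?X \<in> normal_cone spectral_ball D"
      using min[OF cert] by auto
    then have "?X \<bullet> D = ?X \<bullet> Y"
      using cert Yb by (simp add: mem_normal_cone_spectral_ball_iff dual_certificate_iff)
    moreover have "X0 \<bullet> D = X0 \<bullet> Y" "W \<bullet> D = 0" "W \<bullet> Y = 0"
      using cert XY kerY[OF \<Phi>W] Yr by (auto simp: dual_certificate_iff)
    ultimately have "(\<tau>/2)\<^sup>2 * (C \<bullet> D) = (\<tau>/2)\<^sup>2 * (C \<bullet> Y)"
      by (simp only: inner_add_left inner_scaleR_left)
    then show ?thesis
      using \<tau> by (simp add: inner_diff_right)
  qed
  \<comment> \<open>The second-order growth rate along the curve; \<open>ZG\<close> keeps the cost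
    strictly below it.\<close>
  define \<eta> where "\<eta> = c * (norm W)\<^sup>2"
  have \<eta>: "0 < \<eta>"
    using c \<open>W \<noteq> 0\<close> by (simp add: \<eta>_def)
  obtain Z where Zr: "\<And>D. D \<in> range (adjoint \<Phi>) \<Longrightarrow> Z \<bullet> D = 0"
    and ZG: "\<And>D. D \<in> G \<Longrightarrow> (Z - C) \<bullet> (D - Y) < \<eta>"
    using minimax_separation[OF G YG subspace_range_adjoint[OF lin] orth \<eta>] by metis
  have \<Phi>Z: "\<Phi> Z = 0"
    using orthogonal_range_adjoint_imp_ker[OF lin Zr] .
  \<comment> \<open>The shift by two keeps \<open>t k < \<tau>\<close> for every \<open>k\<close>,
    including \<open>0\<close>.\<close>
  define t where "t k = \<tau> / real (k + 2)" for k
  have t: "0 < t k" "t k < \<tau>" for k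
    using \<tau> by (auto simp: t_def divide_less_eq)
  have t0: "t \<longlonglongrightarrow> 0"
    unfolding t_def using LIMSEQ_ignore_initial_segment[OF lim_const_over_n[of \<tau>], of 2] by simp
  define X where "X k = X0 + t k *\<^sub>R W + (t k)\<^sup>2 *\<^sub>R Z" for k
  have "X \<longlonglongrightarrow> X0 + 0 *\<^sub>R W + 0\<^sup>2 *\<^sub>R Z"
    unfolding X_def by (intro tendsto_intros t0)
  then have X0: "X \<longlonglongrightarrow> X0"
    by simp
  have \<Phi>X: "\<Phi> (X k) = \<Phi> X0" for k
    by (simp add: X_def linear_add[OF lin] linear_cmul[OF lin] \<Phi>W \<Phi>Z)
  obtain D r D0 where D: "\<And>k. D k \<in> spectral_ball" "\<And>k. X k \<bullet> D k = nuclear_norm (X k)"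
    and r: "strict_mono r" and limD: "(\<lambda>k. D (r k)) \<longlonglongrightarrow> D0" and D0: "D0 \<in> subdifferential nuclear_norm X0"
    using subgradient_limit[OF X0] by metis
  have limt: "(\<lambda>k. t (r k)) \<longlonglongrightarrow> 0"
    using LIMSEQ_subseq_LIMSEQ[OF t0 r] by (simp add: o_def)
  \<comment> \<open>Weak duality at \<open>X k\<close>, divided by \<open>t k\<close>; the limit
    leaves \<open>0 \<le> W \<bullet> D0\<close>.\<close>
  have "0 \<le> W \<bullet> D k + t k * (Z \<bullet> D k)" for k
  proof -
    have "nuclear_norm X0 \<le> X k \<bullet> D k"
      using dual_certificate_le[OF lin Y \<Phi>X] by (simp add: D(2))
    also have "\<dots> = X0 \<bullet> D k + t k * (W \<bullet> D k + t k * (Z \<bullet> D k))"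
      by (simp add: X_def inner_simps power2_eq_square algebra_simps)
    also have "X0 \<bullet> D k \<le> nuclear_norm X0"
      using D(1) by (rule inner_le_nuclear_norm)
    finally show ?thesis
      using t(1)[of k] by (simp add: zero_le_mult_iff)
  qed
  moreover have "(\<lambda>k. W \<bullet> D (r k) + t (r k) * (Z \<bullet> D (r k))) \<longlonglongrightarrow> W \<bullet> D0 + 0 * (Z \<bullet> D0)"
    by (intro tendsto_intros limD limt)
  ultimately have "0 \<le> W \<bullet> D0 + 0 * (Z \<bullet> D0)"
    by (intro LIMSEQ_le_const) auto
  then have "D0 \<in> G"
    using D0 by (simp add: G_def)
  \<comment> \<open>The arc point \<open>?A\<close> differs from \<open>X k\<close> by a multiple of
    \<open>Z - C\<close>. Duality bounds \<open>?A \<bullet> D k\<close> by the nuclear norm of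
    \<open>?A\<close>, which \<open>Y\<close> attains, and the first-order term vanishes as
    \<open>Y\<close> is orthogonal to \<open>W\<close>.\<close>
  have upper: "nuclear_norm (X k) - nuclear_norm X0 \<le> (t k)\<^sup>2 * ((Z - C) \<bullet> (D k - Y))" for k
  proof -
    let ?A = "X0 + t k *\<^sub>R W + (t k)\<^sup>2 *\<^sub>R C"
    have "X k = ?A + (t k)\<^sup>2 *\<^sub>R (Z - C)"
      by (simp add: X_def algebra_simps)
    then have "nuclear_norm (X k) = ?A \<bullet> D k + (t k)\<^sup>2 * ((Z - C) \<bullet> D k)"
      by (metis D(2) inner_add_left inner_scaleR_left)
    also have "?A \<bullet> D k \<le> nuclear_norm ?A"
      using D(1) by (rule inner_le_nuclear_norm)
    also have "nuclear_norm ?A = ?A \<bullet> Y"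
      using arc[OF t] by (simp add: mem_normal_cone_spectral_ball_iff[OF Yb])
    also have "\<dots> = nuclear_norm X0 + (t k)\<^sup>2 * (C \<bullet> Y)"
      using kerY[OF \<Phi>W Yr] XY by (simp add: inner_simps)
    finally show ?thesis
      using kerY[OF \<Phi>Z Yr] by (simp add: inner_simps algebra_simps)
  qed
  have "eventually (\<lambda>k. dist (X k) X0 < \<epsilon>) sequentially"
    using X0 \<epsilon> by (rule tendstoD)
  then have "eventually (\<lambda>k. c * (norm (W + t k *\<^sub>R Z))\<^sup>2 \<le> (Z - C) \<bullet> (D k - Y)) sequentially"
  proof eventually_elim
    case (elim k)
    have "X k - X0 = t k *\<^sub>R (W + t k *\<^sub>R Z)"
      by (simp add: X_def power2_eq_square algebra_simps)
    then have "(norm (X k - X0))\<^sup>2 = (t k)\<^sup>2 * (norm (W + t k *\<^sub>R Z))\<^sup>2"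
      by (simp add: power_mult_distrib)
    moreover have "c * (norm (X k - X0))\<^sup>2 \<le> nuclear_norm (X k) - nuclear_norm X0"
      using elim by (intro growth \<Phi>X) (simp add: dist_norm)
    ultimately have "(t k)\<^sup>2 * (c * (norm (W + t k *\<^sub>R Z))\<^sup>2) \<le> (t k)\<^sup>2 * ((Z - C) \<bullet> (D k - Y))"
      using upper[of k] by (simp add: mult_ac)
    then show ?case
      using t(1)[of k] by simp
  qed
  then have "eventually (\<lambda>k. c * (norm (W + t (r k) *\<^sub>R Z))\<^sup>2 \<le> (Z - C) \<bullet> (D (r k) - Y)) sequentially"
    by (rule eventually_subseq[OF r])
  moreover have "(\<lambda>k. c * (norm (W + t (r k) *\<^sub>R Z))\<^sup>2) \<longlonglongrightarrow> c * (norm (W + 0 *\<^sub>R Z))\<^sup>2"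
    "(\<lambda>k. (Z - C) \<bullet> (D (r k) - Y)) \<longlonglongrightarrow> (Z - C) \<bullet> (D0 - Y)"
    by (intro tendsto_intros limD limt)+
  ultimately have "c * (norm (W + 0 *\<^sub>R Z))\<^sup>2 \<le> (Z - C) \<bullet> (D0 - Y)"
    by (intro tendsto_le[of sequentially]) auto
  then show False
    using ZG[OF \<open>D0 \<in> G\<close>] by (simp add: \<eta>_def)
qed

theorem theorem5p2:
  fixes \<Phi> :: "real^'n2^'n1 \<Rightarrow> real^'m"
    and M\<^sub>0 :: "real^'m"
    and X\<^sub>0 :: "real^'n2^'n1"
  assumes "CARD('n1) \<le> CARD('n2)"
    and "linear \<Phi>"
    and "optimal_solution \<Phi> M\<^sub>0 X\<^sub>0"
  shows "dual_certificate_set \<Phi> X\<^sub>0 \<noteq> {} \<and>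
    (strong_solution \<Phi> M\<^sub>0 X\<^sub>0 \<longleftrightarrow>
      (\<Inter>Y\<in>dual_certificate_set \<Phi> X\<^sub>0.
         ker \<Phi> \<inter> contingent_cone (normal_cone spectral_ball Y) X\<^sub>0) = {0}) \<and>
    (strong_solution \<Phi> M\<^sub>0 X\<^sub>0 \<longleftrightarrow>
      (\<exists>Y\<in>dual_certificate_set \<Phi> X\<^sub>0.
         ker \<Phi> \<inter> contingent_cone (normal_cone spectral_ball Y) X\<^sub>0 = {0})) \<and>
    (strong_solution \<Phi> M\<^sub>0 X\<^sub>0 \<longleftrightarrow>
      (\<forall>Y\<in>dual_certificate_set \<Phi> X\<^sub>0.
         num_unit_singular_values Y = min_unit_singular_values \<Phi> X\<^sub>0 \<longrightarrow>
         ker \<Phi> \<inter> contingent_cone (normal_cone spectral_ball Y) X\<^sub>0 = {0}))"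
proof -
  note lin = assms(2)
  let ?\<Delta> = "dual_certificate_set \<Phi> X\<^sub>0"
  let ?T = "\<lambda>Y. ker \<Phi> \<inter> contingent_cone (normal_cone spectral_ball Y) X\<^sub>0"
  let ?min = "\<lambda>Y. num_unit_singular_values Y = min_unit_singular_values \<Phi> X\<^sub>0"
  have nonempty: "?\<Delta> \<noteq> {}"
    using dual_certificate_exists[OF lin assms(3)] .
  obtain Y0 where Y0: "Y0 \<in> ?\<Delta>" "?min Y0"
    by (rule min_unit_singular_values_attained[OF nonempty])
  have zero: "0 \<in> ?T Y" if "Y \<in> ?\<Delta>" for Y
    using zero_in_contingent_cone[OF dual_certificate_normal_cone[OF that]]
    by (simp add: ker_def linear_0[OF lin])
  \<comment> \<open>\<open>Y0\<close> belongs to the family and has the smallest cone, so (ii)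
    concerns \<open>Y0\<close> alone.\<close>
  have inter: "(\<Inter>Y\<in>?\<Delta>. ?T Y) = ?T Y0"
    using Y0(1) contingent_cone_mono[OF dual_certificate_normal_cone_minimal[OF lin Y0(1) _ Y0(2)]]
    by blast
  have iv: "?T Y = {0}" if "strong_solution \<Phi> M\<^sub>0 X\<^sub>0" "Y \<in> ?\<Delta>" "?min Y" for Y
    using strong_solution_imp_tangent_trivial[OF lin that(1,2)
        dual_certificate_normal_cone_minimal[OF lin that(2) _ that(3)]] zero[OF that(2)]
    by (auto simp: ker_def)
  have iii: "strong_solution \<Phi> M\<^sub>0 X\<^sub>0" if "Y \<in> ?\<Delta>" "?T Y = {0}" for Y
    using assms(3) strong_solution_if_certificate[OF lin _ that] by (simp add: optimal_solution_def)
  \<comment> \<open>(iii) gives (i), (i) gives (iv), and (iv) at \<open>Y0\<close> gives (ii) and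
    (iii); by \<open>inter\<close>, (ii) gives (iii).\<close>
  show ?thesis
    using nonempty inter iv iii Y0 by metis
qed

end
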